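(* Let $\sigma>0$ and let $\nu,\mu\in\mathbb{T}$ be imaginary units, $\nu^2=\mu^2=-1$. For all $\varphi=\varphi^+e_++\varphi^-e_-$ and $\psi=\psi^+e_++\psi^-e_-$ in $L^2_{\mathbb{T}}(\mathbb{R})$ (with $\varphi^\pm,\psi^\pm\in L^2_{\mathbb{C}}(\mathbb{R})$) and all $Z=z_1+jz_2\in\mathbb{T}$, $$\mathcal{V}^{\sigma,\nu,\mu}_{\mathbb{R},\mathbb{T}}(\varphi,\psi)(Z)=\left(\frac{2\sigma}{\pi}\right)^{1/2}e^{-\frac{\sigma}{4}|z_{2_\mu}|^2}\,\mathcal{V}^{\sigma,\nu}(\varphi^+,\psi^+)(z_{1_\nu})\,e_++\left(\frac{2\sigma}{\pi}\right)^{1/2}e^{-\frac{\sigma}{4}|z_{1_\nu}|^2}\,\mathcal{V}^{\sigma,\mu}(\varphi^-,\psi^-)(z_{2_\mu})\,e_-.$$ Moreover, $\mathcal{V}^{\sigma,\nu,\mu}_{\mathbb{R},\mathbb{T}}(\varphi,\psi)$ belongs to $L^2_{\mathbb{T}}(\mathbb{T})$, and for all $\varphi_1,\varphi_2,\psi_1,\psi_2\in L^2_{\mathbb{T}}(\mathbb{R})$ one has the Moyal identity $$\left\langle \mathcal{V}^{\sigma,\nu,\mu}_{\mathbb{R},\mathbb{T}}(\varphi_1,\psi_1),\mathcal{V}^{\sigma,\nu,\mu}_{\mathbb{R},\mathbb{T}}(\varphi_2,\psi_2)\right\rangle_{L^2_{\mathbb{T}}(\mathbb{T})}=\langle\varp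hi_1,\varphi_2\rangle_{L^2_{\mathbb{T}}(\mathbb{R})}\,\langle\psi_1,\psi_2\rangle_{L^2_{\mathbb{T}}(\mathbb{R})}.$$
   Context: Bicomplex numbers: $\mathbb{T}=\{Z=z_1+jz_2:\ z_1,z_2\in\mathbb{C}\}$ with $i^2=j^2=-1$, $ij=ji$ (a commutative algebra). The idempotents $e_\pm=\frac{1\pm ij}{2}$ satisfy $e_\pm^2=e_\pm$, $e_+e_-=0$, $e_++e_-=1$; every bicomplex number is uniquely $ae_++be_-$ with $a,b\in\mathbb{C}$. The conjugation $Z^*=\overline{z_1}-j\overline{z_2}$ is $(ae_++be_-)^*=\bar a e_++\bar b e_-$. Exponentials are computed componentwise in this decomposition. Function spaces: $L^2_{\mathbb{T}}(X)$ is the space of functions $f=f^+e_++f^-e_-$ with $f^\pm\in L^2_{\mathbb{C}}(X)$, with $\mathbb{T}$-valued inner product $\langle f,g\rangle=\int_X f g^*\,d\lambda=\langle f^+,g^+\rangle e_++\langle f^-,g^-\rangle e_-$, where complex inner products are linear in the first variable. On $X=\mathbb{R}$ the measure is Lebesgue. On $X=\mathbb{T}$, writing $Z=z_1+jz_2$, $z_\ell=x_\ell+iy_\ell$, the measure is normalized as $d\lambda(Z)=\frac14\,dx_1dy_1dx_2dy_2$. Imaginary units: $\nu,\mu\in\mathbb{T}$ with $\nu^2=\mu^2=-1$ (so each is one of $\pm i,\pm j$). There are signs with $\nu e_+=\pm i e_+$ and $\mu e_-=\pm i e_-$; inside the $e_+$ (resp. $e_-$) component, $\nu$ (resp. $\mu$)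 is identified with the corresponding $\pm i\in\mathbb{C}$. For $Z=z_1+jz_2$, $z_\ell=x_\ell+iy_\ell$, put $z_{1_\nu}=x_1+\nu y_1$, $z_{2_\mu}=x_2+\mu y_2$, so $|z_{1_\nu}|^2=x_1^2+y_1^2$, $|z_{2_\mu}|^2=x_2^2+y_2^2$. Complex transform: for $f,g\in L^2_{\mathbb{C}}(\mathbb{R})$, $p,q\in\mathbb{R}$ and $\tau\in\{\nu,\mu\}$, $$\mathcal{V}^{\sigma,\tau}(f,g)(p+\tau q)=\left(\frac{\sigma}{2\pi}\right)^{1/2}\int_{\mathbb{R}}e^{\tau\sigma(x-\frac p2)q}f(x)\overline{g(x-p)}\,dx .$$ Unidimensional bicomplex Fourier--Wigner transform: with $X_e=x_1e_++x_2e_-$, $Y_e=y_1e_++y_2e_-$, $X_e^\dagger=x_2e_++x_1e_-$, $Y_e^\dagger=y_2e_++y_1e_-$, $$\mathcal{V}^{\sigma,\nu,\mu}_{\mathbb{R},\mathbb{T}}(\varphi,\psi)(Z)=\frac{\sigma}{\pi}\,e^{-\frac{\sigma}{4}\left((X_e^\dagger)^2+(Y_e^\dagger)^2\right)}\int_{\mathbb{R}}\varphi(t)\,e^{\sigma(\nu e_++\mu e_-)\left(t-\frac{X_e}{2}\right)Y_e}\left(\psi^+(t-x_1)e_++\psi^-(t-x_2)e_-\right)^*dt .$$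
   Formalization: The second factor of the Moyal identity is the conjugate ⟨ψ₁,ψ₂⟩* = ⟨ψ₂,ψ₁⟩ instead of ⟨ψ₁,ψ₂⟩: the printed formula fails since V is conjugate linear in ψ (all functions 1_[0,1], but ψ₁ = i·1_[0,1], gives −i on the left and i on the right). *)

theory Defs
  imports "HOL-Analysis.Analysis"
begin

section \<open>Bicomplex numbers\<close>

text \<open>\<open>Bicomplex z\<^sub>1 z\<^sub>2\<close> stands for \<open>z\<^sub>1 + j z\<^sub>2\<close>.\<close>

datatype bicomplex = Bicomplex (bc1: complex) (bc2: complex)

lemma bicomplex_eq_iff: "Z = W \<longleftrightarrow> bc1 Z = bc1 W \<and> bc2 Z = bc2 W"
  by (cases Z; cases W) simp

instantiation bicomplex :: comm_ring_1
begin

definition "0 = Bicomplex 0 0"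
definition "1 = Bicomplex 1 0"
definition "Z + W = Bicomplex (bc1 Z + bc1 W) (bc2 Z + bc2 W)"
definition "Z - W = Bicomplex (bc1 Z - bc1 W) (bc2 Z - bc2 W)"
definition "- Z = Bicomplex (- bc1 Z) (- bc2 Z)"
definition "Z * W = Bicomplex (bc1 Z * bc1 W - bc2 Z * bc2 W) (bc1 Z * bc2 W + bc2 Z * bc1 W)"

instance
  by standard
    (auto simp: bicomplex_eq_iff zero_bicomplex_def one_bicomplex_def plus_bicomplex_def
      minus_bicomplex_def uminus_bicomplex_def times_bicomplex_def algebra_simps)

end

lemma bicomplex_sel [simp]:
  "bc1 0 = 0" "bc2 0 = 0"
  "bc1 1 = 1" "bc2 1 = 0"
  "bc1 (Z + W) = bc1 Z + bc1 W" "bc2 (Z + W) = bc2 Z + bc2 W"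
  "bc1 (Z - W) = bc1 Z - bc1 W" "bc2 (Z - W) = bc2 Z - bc2 W"
  "bc1 (- Z) = - bc1 Z" "bc2 (- Z) = - bc2 Z"
  "bc1 (Z * W) = bc1 Z * bc1 W - bc2 Z * bc2 W"
  "bc2 (Z * W) = bc1 Z * bc2 W + bc2 Z * bc1 W"
  by (simp_all add: zero_bicomplex_def one_bicomplex_def plus_bicomplex_def
      minus_bicomplex_def uminus_bicomplex_def times_bicomplex_def)

instantiation bicomplex :: real_algebra_1
begin

definition "r *\<^sub>R Z = Bicomplex (r *\<^sub>R bc1 Z) (r *\<^sub>R bc2 Z)"

instance
  by standard (auto simp: bicomplex_eq_iff scaleR_bicomplex_def algebra_simps)

end

lemma bicomplex_scaleR_sel [simp]:
  "bc1 (r *\<^sub>R Z) = r *\<^sub>R bc1 Z" "bc2 (r *\<^sub>R Z) = r *\<^sub>R bc2 Z"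
  by (simp_all add: scaleR_bicomplex_def)

lemma bicomplex_of_real_sel [simp]:
  "bc1 (of_real r) = of_real r" "bc2 (of_real r) = 0"
  by (simp_all add: of_real_def)

text \<open>The Euclidean structure of \<open>\<real>\<^sup>4\<close> in the coordinates \<open>x\<^sub>1, y\<^sub>1, x\<^sub>2, y\<^sub>2\<close>. Its norm is not
  submultiplicative, so \<^class>\<open>real_normed_algebra\<close> and the library's \<^const>\<open>exp\<close> are not
  available on this type.\<close>

instantiation bicomplex :: real_inner
begin

definition inner_bicomplex_def: "inner Z W = inner (bc1 Z) (bc1 W) + inner (bc2 Z) (bc2 W)"
definition norm_bicomplex_def: "norm Z = sqrt ((norm (bc1 Z))\<^sup>2 + (norm (bc2 Z))\<^sup>2)"
definition sgn_bicomplex_def: "sgn (Z::bicomplex) = Z /\<^sub>R norm Z"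
definition dist_bicomplex_def: "dist (Z::bicomplex) W = norm (Z - W)"
definition uniformity_bicomplex_def [code del]:
  "(uniformity :: (bicomplex \<times> bicomplex) filter) =
    (INF e\<in>{0<..}. principal {(x, y). dist x y < e})"
definition open_bicomplex_def [code del]:
  "open (U :: bicomplex set) \<longleftrightarrow> (\<forall>x\<in>U. eventually (\<lambda>(x', y). x' = x \<longrightarrow> y \<in> U) uniformity)"

instance
proof
  fix x y z :: bicomplex and r :: real
  show "inner x y = inner y x"
    by (simp add: inner_bicomplex_def inner_commute)
  show "inner (x + y) z = inner x z + inner y z"
    by (simp add: inner_bicomplex_def inner_add_left)
  show "inner (r *\<^sub>R x) y = r * inner x y"
    by (simp add: inner_bicomplex_def distrib_left)
  show "0 \<le> inner x x"
    by (simp add: inner_bicomplex_def)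
  show "inner x x = 0 \<longleftrightarrow> x = 0"
    by (simp add: inner_bicomplex_def bicomplex_eq_iff add_nonneg_eq_0_iff)
  show "norm x = sqrt (inner x x)"
    by (simp add: inner_bicomplex_def norm_bicomplex_def power2_norm_eq_inner)
qed (rule sgn_bicomplex_def dist_bicomplex_def open_bicomplex_def uniformity_bicomplex_def)+

end

instantiation bicomplex :: euclidean_space
begin

definition Basis_bicomplex_def:
  "Basis = {Bicomplex 1 0, Bicomplex \<i> 0, Bicomplex 0 1, Bicomplex 0 \<i>}"

instance
proof
  fix u v x :: bicomplex
  show "(Basis :: bicomplex set) \<noteq> {}" and "finite (Basis :: bicomplex set)"
    by (simp_all add: Basis_bicomplex_def)
  show "inner u v = (if u = v then 1 else 0)" if "u \<in> Basis" "v \<in> Basis"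
    using that unfolding Basis_bicomplex_def
    by (elim insertE emptyE; simp add: inner_bicomplex_def)
  show "(\<forall>u\<in>Basis. inner x u = 0) \<longleftrightarrow> x = 0"
    by (simp add: Basis_bicomplex_def inner_bicomplex_def bicomplex_eq_iff complex_eq_iff)
qed

end

definition bc_of_complex :: "complex \<Rightarrow> bicomplex" where
  "bc_of_complex a = Bicomplex a 0"

definition bc_i :: bicomplex where
  "bc_i = bc_of_complex \<i>"

definition bc_j :: bicomplex where
  "bc_j = Bicomplex 0 1"

definition e_plus :: bicomplex where
  "e_plus = (1/2) *\<^sub>R (1 + bc_i * bc_j)"

definition e_minus :: bicomplex where
  "e_minus = (1/2) *\<^sub>R (1 - bc_i * bc_j)"

definition bc_cnj :: "bicomplex \<Rightarrow> bicomplex" where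
  "bc_cnj Z = Bicomplex (cnj (bc1 Z)) (- cnj (bc2 Z))"

text \<open>The idempotent components \<open>a, b\<close> of \<open>Z = a e\<^sub>+ + b e\<^sub>-\<close>; they are characterized
  by lemma \<open>idempotent_decomposition\<close> below.\<close>

definition cplus :: "bicomplex \<Rightarrow> complex" where
  "cplus Z = bc1 Z - \<i> * bc2 Z"

definition cminus :: "bicomplex \<Rightarrow> complex" where
  "cminus Z = bc1 Z + \<i> * bc2 Z"

lemma idempotent_decomposition:
  "Z = bc_of_complex a * e_plus + bc_of_complex b * e_minus \<longleftrightarrow> a = cplus Z \<and> b = cminus Z"
proof -
  have 1: "bc1 (bc_of_complex a * e_plus + bc_of_complex b * e_minus) = (a + b) / 2"
    by (simp add: e_plus_def e_minus_def bc_i_def bc_j_def bc_of_complex_def complex_eq_iff)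
  have 2: "bc2 (bc_of_complex a * e_plus + bc_of_complex b * e_minus) = \<i> * (a - b) / 2"
    by (simp add: e_plus_def e_minus_def bc_i_def bc_j_def bc_of_complex_def complex_eq_iff)
  show ?thesis
    unfolding bicomplex_eq_iff 1 2 cplus_def cminus_def complex_eq_iff by auto
qed

lemma e_plus_e_minus:
  "e_plus * e_plus = e_plus" "e_minus * e_minus = e_minus"
  "e_plus * e_minus = 0" "e_plus + e_minus = 1"
  by (auto simp: bicomplex_eq_iff e_plus_def e_minus_def bc_i_def bc_j_def bc_of_complex_def
      scaleR_conv_of_real complex_eq_iff)

lemma cplus_cminus_arith:
  "cplus (Z + W) = cplus Z + cplus W" "cminus (Z + W) = cminus Z + cminus W"
  "cplus (Z * W) = cplus Z * cplus W" "cminus (Z * W) = cminus Z * cminus W"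
  "cplus (bc_cnj Z) = cnj (cplus Z)" "cminus (bc_cnj Z) = cnj (cminus Z)"
  by (auto simp: cplus_def cminus_def bc_cnj_def complex_eq_iff algebra_simps)

definition bc_exp :: "bicomplex \<Rightarrow> bicomplex" where
  "bc_exp Z = bc_of_complex (exp (cplus Z)) * e_plus + bc_of_complex (exp (cminus Z)) * e_minus"

lemma bicomplex_unit_components:
  assumes "\<nu>\<^sup>2 = (-1 :: bicomplex)"
  shows "cplus \<nu> \<in> {\<i>, -\<i>}" "cminus \<nu> \<in> {\<i>, -\<i>}"
proof -
  have "cplus \<nu> * cplus \<nu> = cplus (-1)" "cminus \<nu> * cminus \<nu> = cminus (-1)"
    using assms by (simp_all add: power2_eq_square flip: cplus_cminus_arith)
  then have "(cplus \<nu>)\<^sup>2 = \<i>\<^sup>2" "(cminus \<nu>)\<^sup>2 = \<i>\<^sup>2"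
    by (simp_all add: cplus_def cminus_def power2_eq_square)
  then show "cplus \<nu> \<in> {\<i>, -\<i>}" "cminus \<nu> \<in> {\<i>, -\<i>}"
    by (simp_all only: power2_eq_iff insert_iff empty_iff simp_thms)
qed


section \<open>Function spaces\<close>

text \<open>The \<open>L\<^sup>2\<close> spaces consist of functions, not of classes modulo almost everywhere equality.\<close>

definition L2 :: "'a measure \<Rightarrow> ('a \<Rightarrow> complex) set" where
  "L2 M = {f. f \<in> borel_measurable M \<and> integrable M (\<lambda>x. (norm (f x))\<^sup>2)}"

definition L2_bc :: "'a measure \<Rightarrow> ('a \<Rightarrow> bicomplex) set" where
  "L2_bc M = {f. (\<lambda>x. cplus (f x)) \<in> L2 M \<and> (\<lambda>x. cminus (f x)) \<in> L2 M}"

text \<open>Linear in \<open>f\<close>, conjugate linear in \<open>g\<close>. The transform \<open>bc_FW\<close> below is conjugate linear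
  in its second function \<open>\<psi>\<close>, so that the right-hand side of the Moyal identity must be conjugate
  linear in \<open>\<psi>\<^sub>1\<close>: its second factor is the conjugate of \<open>\<langle>\<psi>\<^sub>1, \<psi>\<^sub>2\<rangle>\<close>, that is
  \<open>\<langle>\<psi>\<^sub>2, \<psi>\<^sub>1\<rangle>\<close>.\<close>

definition bc_inner :: "'a measure \<Rightarrow> ('a \<Rightarrow> bicomplex) \<Rightarrow> ('a \<Rightarrow> bicomplex) \<Rightarrow> bicomplex" where
  "bc_inner M f g = (LINT x|M. f x * bc_cnj (g x))"

text \<open>The measure \<open>(1/4) dx\<^sub>1 dy\<^sub>1 dx\<^sub>2 dy\<^sub>2\<close>.\<close>

definition bc_measure :: "bicomplex measure" where
  "bc_measure = density lebesgue (\<lambda>_. ennreal (1/4))"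


section \<open>Fourier--Wigner transforms\<close>

text \<open>Here \<open>\<tau> = \<plusminus>\<i>\<close> and \<open>w = p + \<tau> q\<close> with \<open>p, q\<close> real, so that \<open>q = Im w / Im \<tau>\<close>;
  see lemma \<open>FW_eq\<close>.\<close>

definition FW :: "real \<Rightarrow> complex \<Rightarrow> (real \<Rightarrow> complex) \<Rightarrow> (real \<Rightarrow> complex) \<Rightarrow> complex \<Rightarrow> complex" where
  "FW \<sigma> \<tau> f g w =
    (let p = Re w; q = Im w / Im \<tau> in
      of_real (sqrt (\<sigma> / (2 * pi))) *
      (LINT x|lebesgue. exp (\<tau> * of_real (\<sigma> * (x - p / 2) * q)) * f x * cnj (g (x - p))))"

lemma FW_eq:
  assumes "\<tau> \<in> {\<i>, -\<i>}"
  shows "FW \<sigma> \<tau> f g (of_real p + \<tau> * of_real q) =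
    of_real (sqrt (\<sigma> / (2 * pi))) *
    (LINT x|lebesgue. exp (\<tau> * of_real (\<sigma> * (x - p / 2) * q)) * f x * cnj (g (x - p)))"
  using assms by (auto simp: FW_def Let_def)

text \<open>For a bicomplex unit \<open>\<nu>\<close> these are \<open>x\<^sub>1 + \<nu> y\<^sub>1\<close> and \<open>x\<^sub>2 + \<nu> y\<^sub>2\<close>. Their images in the
  copies of \<open>\<complex>\<close> spanned by \<open>e\<^sub>+\<close> and \<open>e\<^sub>-\<close> are given by \<^const>\<open>cplus\<close> and \<^const>\<open>cminus\<close>.\<close>

definition z1_unit :: "bicomplex \<Rightarrow> bicomplex \<Rightarrow> bicomplex" where
  "z1_unit \<nu> Z = of_real (Re (bc1 Z)) + \<nu> * of_real (Im (bc1 Z))"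

definition z2_unit :: "bicomplex \<Rightarrow> bicomplex \<Rightarrow> bicomplex" where
  "z2_unit \<mu> Z = of_real (Re (bc2 Z)) + \<mu> * of_real (Im (bc2 Z))"

lemma cmod_units:
  assumes "\<nu>\<^sup>2 = (-1 :: bicomplex)"
  shows "(cmod (cplus (z1_unit \<nu> Z)))\<^sup>2 = (Re (bc1 Z))\<^sup>2 + (Im (bc1 Z))\<^sup>2"
    and "(cmod (cminus (z2_unit \<nu> Z)))\<^sup>2 = (Re (bc2 Z))\<^sup>2 + (Im (bc2 Z))\<^sup>2"
proof -
  have "cplus (of_real r) = of_real r" "cminus (of_real r) = of_real r" for r
    by (simp_all add: cplus_def cminus_def)
  then show "(cmod (cplus (z1_unit \<nu> Z)))\<^sup>2 = (Re (bc1 Z))\<^sup>2 + (Im (bc1 Z))\<^sup>2"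
    and "(cmod (cminus (z2_unit \<nu> Z)))\<^sup>2 = (Re (bc2 Z))\<^sup>2 + (Im (bc2 Z))\<^sup>2"
    using bicomplex_unit_components[OF assms]
    by (auto simp: z1_unit_def z2_unit_def cplus_cminus_arith cmod_power2)
qed

definition bc_FW ::
  "real \<Rightarrow> bicomplex \<Rightarrow> bicomplex \<Rightarrow> (real \<Rightarrow> bicomplex) \<Rightarrow> (real \<Rightarrow> bicomplex) \<Rightarrow> bicomplex \<Rightarrow> bicomplex"
where
  "bc_FW \<sigma> \<nu> \<mu> \<phi> \<psi> Z =
    (let x1 = Re (bc1 Z); y1 = Im (bc1 Z); x2 = Re (bc2 Z); y2 = Im (bc2 Z);
         X = x1 *\<^sub>R e_plus + x2 *\<^sub>R e_minus; X' = x2 *\<^sub>R e_plus + x1 *\<^sub>R e_minus;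
         Y = y1 *\<^sub>R e_plus + y2 *\<^sub>R e_minus; Y' = y2 *\<^sub>R e_plus + y1 *\<^sub>R e_minus
     in (\<sigma> / pi) *\<^sub>R bc_exp ((- \<sigma> / 4) *\<^sub>R (X'\<^sup>2 + Y'\<^sup>2)) *
        (LINT t|lebesgue.
           \<phi> t *
           bc_exp (\<sigma> *\<^sub>R ((\<nu> * e_plus + \<mu> * e_minus) * (of_real t - (1/2) *\<^sub>R X) * Y)) *
           bc_cnj (bc_of_complex (cplus (\<psi> (t - x1))) * e_plus +
                   bc_of_complex (cminus (\<psi> (t - x2))) * e_minus)))"

end

theory Submission
  imports Defs "HOL-Probability.Probability"
begin


text \<open>In idempotent components, \<^const>\<open>bc_FW\<close> is the complex transform \<^const>\<open>FW\<close> in one pair of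
  real coordinates times a Gaussian in the other pair, so the Moyal identity factorizes into the
  integral of a Gaussian and the Moyal identity for \<^const>\<open>FW\<close>. For fixed \<open>p\<close> and up to a phase,
  \<^const>\<open>FW\<close> is the Fourier transform of \<open>x \<mapsto> f x * cnj (g (x - p))\<close>, which is integrable, and is
  square integrable for almost every \<open>p\<close>; Plancherel in \<open>q\<close> followed by Fubini in \<open>(x, p)\<close> gives
  the identity. Plancherel on the intersection of \<open>L\<^sup>1\<close> and \<open>L\<^sup>2\<close> is obtained by inserting a
  Gaussian factor \<open>exp (- (e * k)\<^sup>2 / 2)\<close>, which turns the pairing of two Fourier transforms into
  a Gaussian average of the correlation \<open>u \<mapsto> \<integral> h1 x * cnj (h2 (x - u)) dx\<close>, a function
  that is continuous at \<open>0\<close>, and letting \<open>e\<close> tend to \<open>0\<close>.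

  Lebesgue measurable functions are first replaced by Borel representatives, for which product
  measures are available; this changes no value of the transforms.\<close>

section \<open>Square integrable functions\<close>

lemma L2D:
  assumes "f \<in> L2 M"
  shows "f \<in> borel_measurable M" "integrable M (\<lambda>x. (norm (f x))\<^sup>2)"
  using assms by (auto simp: L2_def)

lemma borel_measurable_cnj [measurable (raw)]:
  "f \<in> borel_measurable M \<Longrightarrow> (\<lambda>x. cnj (f x)) \<in> borel_measurable M"
  by (rule borel_measurable_continuous_on[OF continuous_on_cnj[OF continuous_on_id]])

lemma norm_mult_le_sum_squares: "norm (a * b) \<le> (norm a)\<^sup>2 + (norm b)\<^sup>2" for a b :: complex
proof -
  have "0 \<le> (norm a - norm b)\<^sup>2" "0 \<le> norm a * norm b" by simp_all
  then have "norm a * norm b \<le> (norm a)\<^sup>2 + (norm b)\<^sup>2"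
    unfolding power2_diff by linarith
  then show ?thesis by (simp add: norm_mult)
qed

lemma L2_mult_integrable:
  assumes "f \<in> L2 M" "g \<in> L2 M"
  shows "integrable M (\<lambda>x. f x * g x)"
proof (rule Bochner_Integration.integrable_bound)
  show "integrable M (\<lambda>x. (norm (f x))\<^sup>2 + (norm (g x))\<^sup>2)"
    using L2D[OF assms(1)] L2D[OF assms(2)] by auto
  show "(\<lambda>x. f x * g x) \<in> borel_measurable M"
    using L2D[OF assms(1)] L2D[OF assms(2)] by auto
qed (use norm_mult_le_sum_squares in auto)

lemma L2_cnj: "f \<in> L2 M \<Longrightarrow> (\<lambda>x. cnj (f x)) \<in> L2 M"
  by (auto simp: L2_def)

lemma L2_mult_cnj_integrable:
  assumes "f \<in> L2 M" "g \<in> L2 M"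
  shows "integrable M (\<lambda>x. f x * cnj (g x))"
  using L2_mult_integrable[OF assms(1) L2_cnj[OF assms(2)]] .

lemma L2_bound:
  assumes "g \<in> borel_measurable M" "f \<in> L2 M" "\<And>x. norm (g x) \<le> norm (f x)"
  shows "g \<in> L2 M"
proof -
  have "integrable M (\<lambda>x. (norm (g x))\<^sup>2)"
    by (rule Bochner_Integration.integrable_bound[OF L2D(2)[OF assms(2)]])
      (use assms in \<open>auto intro!: power_mono\<close>)
  then show ?thesis using assms by (auto simp: L2_def)
qed

lemma L2_diff:
  assumes "f \<in> L2 M" "g \<in> L2 M"
  shows "(\<lambda>x. f x - g x) \<in> L2 M"
proof -
  have "integrable M (\<lambda>x. (norm (f x - g x))\<^sup>2)"
  proof (rule Bochner_Integration.integrable_bound)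
    show "integrable M (\<lambda>x. 2 * (norm (f x))\<^sup>2 + 2 * (norm (g x))\<^sup>2)"
      using L2D[OF assms(1)] L2D[OF assms(2)] by auto
    have "(norm (a - b))\<^sup>2 \<le> 2 * (norm a)\<^sup>2 + 2 * (norm b)\<^sup>2" for a b :: complex
    proof -
      have "(norm (a - b))\<^sup>2 \<le> (norm a + norm b)\<^sup>2"
        by (intro power_mono norm_triangle_ineq4) auto
      moreover have "0 \<le> (norm a - norm b)\<^sup>2" by simp
      ultimately show ?thesis by (simp add: power2_eq_square algebra_simps)
    qed
    then show "AE x in M. norm ((norm (f x - g x))\<^sup>2) \<le> norm (2 * (norm (f x))\<^sup>2 + 2 * (norm (g x))\<^sup>2)"
      by simp
  qed (use L2D[OF assms(1)] L2D[OF assms(2)] in auto)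
  then show ?thesis using assms by (auto simp: L2_def)
qed

lemma L2_affine:
  fixes f :: "real \<Rightarrow> complex"
  assumes "f \<in> L2 lborel" "c \<noteq> 0"
  shows "(\<lambda>x. f (t + c * x)) \<in> L2 lborel"
  using L2D[OF assms(1)] lborel_integrable_real_affine[of "\<lambda>x. (norm (f x))\<^sup>2" c t] assms(2)
  by (auto simp: L2_def)

lemma L2_shift:
  fixes f :: "real \<Rightarrow> complex"
  assumes "f \<in> L2 lborel"
  shows "(\<lambda>x. f (x - u)) \<in> L2 lborel"
  using L2_affine[OF assms, of 1 "-u"] by simp

text \<open>The inequality holds for integrals of nonnegative extended reals; square integrability
  makes all three of them finite, so it carries over to Bochner integrals. The form is bilinear, and
  conjugates enter through \<open>L2_cnj\<close>.\<close>

lemma L2_Cauchy_Schwarz: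
  assumes "f \<in> L2 M" "g \<in> L2 M"
  shows "norm (LINT x|M. f x * g x) \<le> sqrt (LINT x|M. (norm (f x))\<^sup>2) * sqrt (LINT x|M. (norm (g x))\<^sup>2)"
proof -
  note [measurable] = L2D(1)[OF assms(1)] L2D(1)[OF assms(2)]
  let ?I = "LINT x|M. norm (f x) * norm (g x)"
  let ?F = "LINT x|M. (norm (f x))\<^sup>2" and ?G = "LINT x|M. (norm (g x))\<^sup>2"
  have i: "integrable M (\<lambda>x. norm (f x) * norm (g x))"
    using L2_mult_integrable[OF assms, THEN integrable_norm] by (simp add: norm_mult)
  have "(\<integral>\<^sup>+x. ennreal (norm (f x)) * ennreal (norm (g x)) \<partial>M)\<^sup>2 \<le>
      (\<integral>\<^sup>+x. ennreal (norm (f x)) ^ 2 \<partial>M) * (\<integral>\<^sup>+x. ennreal (norm (g x)) ^ 2 \<partial>M)"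
    by (rule Cauchy_Schwarz_nn_integral) auto
  also have "(\<integral>\<^sup>+x. ennreal (norm (f x)) * ennreal (norm (g x)) \<partial>M) = ennreal ?I"
    using nn_integral_eq_integral[OF i] by (simp add: ennreal_mult'')
  also have "(\<integral>\<^sup>+x. ennreal (norm (f x)) ^ 2 \<partial>M) = ennreal ?F"
    using nn_integral_eq_integral[OF L2D(2)[OF assms(1)]] by (simp add: ennreal_power)
  also have "(\<integral>\<^sup>+x. ennreal (norm (g x)) ^ 2 \<partial>M) = ennreal ?G"
    using nn_integral_eq_integral[OF L2D(2)[OF assms(2)]] by (simp add: ennreal_power)
  finally have "?I\<^sup>2 \<le> ?F * ?G"
    by (simp add: ennreal_power flip: ennreal_mult)
  then have "?I \<le> sqrt ?F * sqrt ?G"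
    by (metis real_le_rsqrt real_sqrt_mult)
  moreover have "norm (LINT x|M. f x * g x) \<le> ?I"
    using integral_norm_bound[of M "\<lambda>x. f x * g x"] by (simp add: norm_mult)
  ultimately show ?thesis by simp
qed

text \<open>Source of dominating functions for bounded functions that vanish outside a bounded
  interval.\<close>

lemma L2_indicator_Icc:
  "(\<lambda>x::real. of_real (indicator {a..b} x) * (c::complex)) \<in> L2 lborel"
proof -
  have "integrable lborel (\<lambda>x::real. indicator {a..b} x * (norm c)\<^sup>2)"
    by (intro integrable_mult_left integrable_real_indicator) (auto simp: emeasure_lborel_Icc_eq)
  also have "(\<lambda>x::real. indicator {a..b} x * (norm c)\<^sup>2) =
      (\<lambda>x. (norm (of_real (indicator {a..b} x) * c))\<^sup>2)"
    by (auto simp: indicator_def norm_mult fun_eq_iff)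
  finally show ?thesis by (simp add: L2_def)
qed

section \<open>Continuity of correlations\<close>

text \<open>At each point the truncations at height and radius \<open>m\<close> eventually agree
  with \<open>h\<close>, and the squared error never exceeds that of the zero function, so dominated
  convergence applies.\<close>

lemma L2_dense_truncated:
  assumes "h \<in> L2 (lborel :: real measure)" "e > 0"
  obtains k :: "real \<Rightarrow> complex" and m :: real where "k \<in> L2 lborel" "0 < m" "\<And>x. norm (k x) \<le> m"
    "\<And>x. m < \<bar>x\<bar> \<Longrightarrow> k x = 0" "(LINT x|lborel. (norm (h x - k x))\<^sup>2) < e"
proof -
  note [measurable] = L2D(1)[OF assms(1)]
  define k where "k m x = (if norm (h x) \<le> real m \<and> \<bar>x\<bar> \<le> real m then h x else 0)" for m x
  have [measurable]: "k m \<in> borel_measurable lborel" for m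
    unfolding k_def by measurable
  have "(\<lambda>m. LINT x|lborel. (norm (h x - k m x))\<^sup>2) \<longlonglongrightarrow> (LINT x|(lborel::real measure). 0)"
  proof (rule integral_dominated_convergence[OF _ _ L2D(2)[OF assms(1)]])
    show "AE x in lborel. (\<lambda>m. (norm (h x - k m x))\<^sup>2) \<longlonglongrightarrow> 0"
    proof (rule AE_I2)
      fix x
      have "\<forall>\<^sub>F m in sequentially. max (norm (h x)) \<bar>x\<bar> \<le> real m"
        using filterlim_real_sequentially unfolding filterlim_at_top by blast
      then have "\<forall>\<^sub>F m in sequentially. (norm (h x - k m x))\<^sup>2 = 0"
        by eventually_elim (auto simp: k_def)
      then show "(\<lambda>m. (norm (h x - k m x))\<^sup>2) \<longlonglongrightarrow> 0"
        by (simp add: tendsto_eventually)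
    qed
  qed (auto simp: k_def)
  then have "(\<lambda>m. LINT x|lborel. (norm (h x - k m x))\<^sup>2) \<longlonglongrightarrow> 0"
    by simp
  from order_tendstoD(2)[OF this \<open>e > 0\<close>]
  obtain N where N: "\<And>m. N \<le> m \<Longrightarrow> (LINT x|lborel. (norm (h x - k m x))\<^sup>2) < e"
    by (auto simp: eventually_sequentially)
  show thesis
  \<comment> \<open>\<open>Suc N\<close> rather than \<open>N\<close>, because the bound has to be
    positive.\<close>
  proof (rule that[of "k (Suc N)" "real (Suc N)"])
    show "k (Suc N) \<in> L2 lborel"
      by (rule L2_bound[OF _ assms(1)]) (auto simp: k_def)
    show "(LINT x|lborel. (norm (h x - k (Suc N) x))\<^sup>2) < e"
      by (rule N) simp
  qed (auto simp: k_def)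
qed

text \<open>A measurable function is an almost everywhere limit of continuous ones; projecting these onto
  a ball and cutting them off makes the convergence dominated.\<close>

lemma L2_dense_continuous_truncated:
  fixes k :: "real \<Rightarrow> complex"
  assumes "k \<in> L2 (lborel :: real measure)" "0 < m" "\<And>x. norm (k x) \<le> m"
    "\<And>x. m < \<bar>x\<bar> \<Longrightarrow> k x = 0" "e > 0"
  obtains g where "continuous_on UNIV g" "\<And>x. norm (g x) \<le> m" "\<And>x. m + 1 < \<bar>x\<bar> \<Longrightarrow> g x = 0"
    "g \<in> L2 lborel" "(LINT x|lborel. (norm (k x - g x))\<^sup>2) < e"
proof -
  note [measurable] = L2D(1)[OF assms(1)]
  have "k \<in> borel_measurable lebesgue"
    by (rule measurable_completion) measurable
  then have "k measurable_on UNIV"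
    by (intro lebesgue_measurable_imp_measurable_on) auto
  then obtain N g where N: "negligible N" and gc: "\<And>n. continuous_on UNIV (g n)"
    and gl: "\<And>x. x \<notin> N \<Longrightarrow> (\<lambda>n. g n x) \<longlonglongrightarrow> k x"
    unfolding measurable_on_def by auto
  \<comment> \<open>The cutoff \<open>c\<close> is continuous and equals 1 wherever \<open>k\<close>
    may be nonzero; the projection onto the ball is continuous and fixes the values of
    \<open>k\<close>. Hence \<open>G n\<close> is bounded, vanishes beyond \<open>m + 1\<close>, and
    still tends to \<open>k\<close> off \<open>N\<close>.\<close>
  define c where "c x = max 0 (min 1 (m + 1 - \<bar>x\<bar>))" for x :: real
  define G where "G n x = of_real (c x) * closest_point (cball 0 m) (g n x)" for n x
  have c: "0 \<le> c x" "c x \<le> 1" "m + 1 < \<bar>x\<bar> \<Longrightarrow> c x = 0" "\<bar>x\<bar> \<le> m \<Longrightarrow> c x = 1" for x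
    by (auto simp: c_def)
  have Gc: "continuous_on UNIV (G n)" for n
    unfolding G_def c_def
    by (intro continuous_intros continuous_on_compose2[OF continuous_on_closest_point gc])
      (use \<open>0 < m\<close> in auto)
  then have [measurable]: "G n \<in> borel_measurable lborel" for n
    by (simp add: borel_measurable_continuous_onI)
  have cp: "norm (closest_point (cball 0 m) z) \<le> m" for z :: complex
    using closest_point_in_set[of "cball 0 m" z] \<open>0 < m\<close> by auto
  have Gb: "norm (G n x) \<le> m" for n x
    using mult_mono[OF c(2)[of x] cp[of "g n x"]] c(1)[of x] \<open>0 < m\<close>
    by (simp add: G_def norm_mult)
  have G0: "G n x = 0" if "m + 1 < \<bar>x\<bar>" for n x
    using c(3)[OF that] by (simp add: G_def)
  have Gl: "(\<lambda>n. G n x) \<longlonglongrightarrow> k x" if "x \<notin> N" for x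
  proof -
    have "isCont (closest_point (cball 0 m)) (k x)"
      using \<open>0 < m\<close> by (intro continuous_at_closest_point) auto
    then have "(\<lambda>n. of_real (c x) * closest_point (cball 0 m) (g n x)) \<longlonglongrightarrow>
        of_real (c x) * closest_point (cball 0 m) (k x)"
      by (intro tendsto_mult tendsto_const isCont_tendsto_compose[OF _ gl[OF that]])
    also have "closest_point (cball 0 m) (k x) = k x"
      using assms(3)[of x] by (intro closest_point_self) auto
    also have "of_real (c x) * k x = k x"
      using assms(4)[of x] c(4)[of x] by (cases "\<bar>x\<bar> \<le> m") auto
    finally show ?thesis by (simp add: G_def)
  qed
  have Nae: "AE x in lborel. x \<notin> N"
    using N by (metis AE_completion_iff AE_not_in negligible_iff_null_sets)
  \<comment> \<open>Both functions are bounded by \<open>m\<close>, which gives \<open>2 * m\<close>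
    for the difference. The majorant is written as a squared norm so that
    \<open>L2_indicator_Icc\<close> makes it integrable.\<close>
  let ?w = "\<lambda>x::real. (norm (of_real (indicator {-(m+1)..m+1} x) * of_real (2 * m) :: complex))\<^sup>2"
  have "(\<lambda>n. LINT x|lborel. (norm (k x - G n x))\<^sup>2) \<longlonglongrightarrow> (LINT x|(lborel::real measure). 0)"
  proof (rule integral_dominated_convergence)
    show "integrable lborel ?w"
      by (rule L2D(2)[OF L2_indicator_Icc])
    show "AE x in lborel. (\<lambda>n. (norm (k x - G n x))\<^sup>2) \<longlonglongrightarrow> 0"
      using Nae
    proof eventually_elim
      case (elim x)
      have "(\<lambda>n. (norm (k x - G n x))\<^sup>2) \<longlonglongrightarrow> (norm (k x - k x))\<^sup>2"
        by (intro tendsto_intros Gl elim)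
      then show ?case by simp
    qed
    fix n
    show "AE x in lborel. norm ((norm (k x - G n x))\<^sup>2) \<le> ?w x"
    proof (rule AE_I2)
      fix x
      show "norm ((norm (k x - G n x))\<^sup>2) \<le> ?w x"
      proof (cases "\<bar>x\<bar> \<le> m + 1")
        case True
        have "norm (k x - G n x) \<le> 2 * m"
          using norm_triangle_ineq4[of "k x" "G n x"] assms(3)[of x] Gb[of n x] by simp
        then have "(norm (k x - G n x))\<^sup>2 \<le> (2 * m)\<^sup>2"
          by (intro power_mono) auto
        with True show ?thesis using \<open>0 < m\<close> by (simp add: indicator_def norm_mult abs_le_iff)
      next
        case False
        then show ?thesis using assms(4)[of x] G0[of x n] \<open>0 < m\<close> by simp
      qed
    qed
  qed auto
  then have "(\<lambda>n. LINT x|lborel. (norm (k x - G n x))\<^sup>2) \<longlonglongrightarrow> 0"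
    by simp
  from order_tendstoD(2)[OF this \<open>e > 0\<close>]
  obtain n where n: "(LINT x|lborel. (norm (k x - G n x))\<^sup>2) < e"
    by (auto simp: eventually_sequentially)
  have "G n \<in> L2 lborel"
  proof (rule L2_bound[OF _ L2_indicator_Icc[of "-(m+1)" "m+1" "of_real m"]])
    fix x
    show "norm (G n x) \<le> norm (of_real (indicator {-(m+1)..m+1} x) * (of_real m :: complex))"
      using Gb[of n x] G0[of x n] \<open>0 < m\<close>
      by (cases "\<bar>x\<bar> \<le> m + 1") (auto simp: indicator_def norm_mult abs_le_iff)
  qed simp
  with that[of "G n"] Gc Gb G0 n show thesis by blast
qed

text \<open>Cauchy-Schwarz and translation invariance. The bound does not depend on the shift
  \<open>u\<close>; approximation errors and dominations below rely on this uniformity.\<close>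

lemma correlation_bound:
  assumes "h1 \<in> L2 lborel" "h2 \<in> L2 (lborel :: real measure)"
  shows "norm (LINT x|lborel. h1 x * cnj (h2 (x - u))) \<le>
    sqrt (LINT x|lborel. (norm (h1 x))\<^sup>2) * sqrt (LINT x|lborel. (norm (h2 x))\<^sup>2)"
proof -
  have "(LINT x|lborel. (norm (h2 x))\<^sup>2) = (LINT x|lborel. (norm (h2 (x - u)))\<^sup>2)"
    using lborel_integral_real_affine[of 1 "\<lambda>x. (norm (h2 x))\<^sup>2" "-u"] by simp
  with L2_Cauchy_Schwarz[OF assms(1) L2_cnj[OF L2_shift[OF assms(2), of u]]] show ?thesis
    by simp
qed

text \<open>The case in which continuity gives pointwise convergence of the integrands, so that
  dominated convergence suffices. The number \<open>m\<close> is both the bound and the radius of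
  the support.\<close>

lemma correlation_tendsto_continuous:
  assumes h: "h \<in> L2 (lborel :: real measure)" and g: "continuous_on UNIV g"
    and b: "\<And>x. norm (g x) \<le> m" and z: "\<And>x. m < \<bar>x\<bar> \<Longrightarrow> g x = 0" and u: "u \<longlonglongrightarrow> 0"
  shows "(\<lambda>n. LINT x|lborel. h x * cnj (g (x - u n))) \<longlonglongrightarrow> (LINT x|lborel. h x * cnj (g x))"
proof -
  note [measurable] = L2D(1)[OF h]
  have [measurable]: "g \<in> borel_measurable borel"
    using g by (rule borel_measurable_continuous_onI)
  have m: "0 \<le> m" using b[of 0] norm_ge_zero order_trans by blast
  obtain B where B: "\<And>n. \<bar>u n\<bar> \<le> B"
    using convergent_imp_Bseq[of u] u by (auto simp: convergent_def Bseq_def)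
  \<comment> \<open>If \<open>m + B < \<bar>x\<bar>\<close>, then \<open>x - u n\<close> lies
    outside the support for every \<open>n\<close>; a single box of height \<open>m\<close>
    therefore dominates all translates.\<close>
  let ?w = "\<lambda>x. norm (h x * (of_real (indicator {-(m+B)..m+B} x) * of_real m))"
  show ?thesis
  proof (rule integral_dominated_convergence)
    show "integrable lborel ?w"
      by (intro integrable_norm L2_mult_integrable h L2_indicator_Icc)
    show "AE x in lborel. (\<lambda>n. h x * cnj (g (x - u n))) \<longlonglongrightarrow> h x * cnj (g x)"
    proof (rule AE_I2, intro tendsto_mult tendsto_const tendsto_cnj)
      fix x
      have "(\<lambda>n. x - u n) \<longlonglongrightarrow> x" using tendsto_diff[OF tendsto_const u, of x] by simp
      moreover have "isCont g x" using g by (simp add: continuous_on_eq_continuous_at)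
      ultimately show "(\<lambda>n. g (x - u n)) \<longlonglongrightarrow> g x" by (rule isCont_tendsto_compose[rotated])
    qed
    fix n
    show "AE x in lborel. norm (h x * cnj (g (x - u n))) \<le> ?w x"
    proof (rule AE_I2)
      fix x
      show "norm (h x * cnj (g (x - u n))) \<le> ?w x"
        using b[of "x - u n"] z[of "x - u n"] B[of n] m
        by (cases "\<bar>x\<bar> \<le> m + B") (auto simp: indicator_def norm_mult abs_le_iff intro!: mult_left_mono)
    qed
  qed auto
qed

text \<open>An approximation argument in three parts: \<open>h2\<close> is replaced by a continuous
  function \<open>g\<close> of bounded support, at a cost that is uniform in the shift by
  \<open>correlation_bound\<close>, and for \<open>g\<close> the limit is already known.\<close>

lemma correlation_tendsto:
  assumes h1: "h1 \<in> L2 lborel" and h2: "h2 \<in> L2 (lborel :: real measure)" and u: "u \<longlonglongrightarrow> 0"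
  shows "(\<lambda>n. LINT x|lborel. h1 x * cnj (h2 (x - u n))) \<longlonglongrightarrow> (LINT x|lborel. h1 x * cnj (h2 x))"
proof (rule LIMSEQ_I)
  let ?A = "\<lambda>g v. LINT x|lborel. h1 x * cnj (g (x - v))"
  let ?N = "sqrt (LINT x|lborel. (norm (h1 x))\<^sup>2)"
  fix r :: real assume r: "0 < r"
  \<comment> \<open>The replacements of \<open>h2\<close> by \<open>k\<close> and of
    \<open>k\<close> by \<open>g\<close> cost at most \<open>?N * d \<le> r / 6\<close> each, hence
    \<open>r / 3\<close> together. This is paid at the shifts \<open>u n\<close> and
    \<open>0\<close>, which leaves \<open>r / 3\<close> for \<open>g\<close>. Adding 1 keeps the
    denominator positive when \<open>?N = 0\<close>.\<close>
  define d where "d = r / (6 * (?N + 1))"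
  have d: "0 < d" "?N * d \<le> r / 6"
  proof -
    have N: "0 < ?N + 1" by (intro add_nonneg_pos) auto
    with r show "0 < d" unfolding d_def by (intro divide_pos_pos mult_pos_pos) auto
    then have "?N * d \<le> (?N + 1) * d" by (intro mult_right_mono) auto
    also have "\<dots> = r / 6"
    proof -
      have "n * (r / (6 * n)) = r / 6" if "0 < n" for n :: real using that by simp
      from this[OF N] show ?thesis by (simp only: d_def)
    qed
    finally show "?N * d \<le> r / 6" .
  qed
  obtain k m where k: "k \<in> L2 lborel" "0 < m" "\<And>x. norm (k x) \<le> m"
    "\<And>x. m < \<bar>x\<bar> \<Longrightarrow> k x = 0" and kd: "(LINT x|lborel. (norm (h2 x - k x))\<^sup>2) < d\<^sup>2"
    using L2_dense_truncated[OF h2, of "d\<^sup>2"] d by auto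
  obtain g where g: "continuous_on UNIV g" "\<And>x. norm (g x) \<le> m" "\<And>x. m + 1 < \<bar>x\<bar> \<Longrightarrow> g x = 0"
    and g2: "g \<in> L2 lborel" and gd: "(LINT x|lborel. (norm (k x - g x))\<^sup>2) < d\<^sup>2"
    using L2_dense_continuous_truncated[OF k, of "d\<^sup>2"] d by auto
  have close: "norm (?A f v - ?A f' v) \<le> r / 6"
    if f: "f \<in> L2 lborel" "f' \<in> L2 lborel" "(LINT x|lborel. (norm (f x - f' x))\<^sup>2) < d\<^sup>2" for f f' v
  proof -
    have "?A f v - ?A f' v = ?A (\<lambda>x. f x - f' x) v"
      by (subst Bochner_Integration.integral_diff[symmetric])
        (auto intro!: L2_mult_cnj_integrable h1 L2_shift f simp: algebra_simps)
    also have "norm \<dots> \<le> ?N * sqrt (LINT x|lborel. (norm (f x - f' x))\<^sup>2)"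
      by (rule correlation_bound[OF h1 L2_diff[OF f(1,2)]])
    also have "\<dots> \<le> ?N * sqrt (d\<^sup>2)"
      by (intro mult_left_mono real_sqrt_le_mono) (use f(3) in auto)
    finally show ?thesis using d by simp
  qed
  have close2: "norm (?A h2 v - ?A g v) \<le> r / 3" for v
    using norm_triangle_le[of "?A h2 v - ?A k v" "?A k v - ?A g v" "r / 3"]
      close[OF h2 k(1) kd, of v] close[OF k(1) g2 gd, of v] by simp
  \<comment> \<open>\<open>g\<close> is bounded by \<open>m\<close> but its support reaches up to
    \<open>m + 1\<close>; the larger number serves as both bound and radius.\<close>
  have "(\<lambda>n. ?A g (u n)) \<longlonglongrightarrow> (LINT x|lborel. h1 x * cnj (g x))"
  proof (rule correlation_tendsto_continuous[OF h1 g(1) _ g(3) u])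
    show "norm (g x) \<le> m + 1" for x
      using g(2)[of x] by simp
  qed
  then obtain n0 where n0: "\<And>n. n0 \<le> n \<Longrightarrow> norm (?A g (u n) - ?A g 0) < r / 3"
    using r LIMSEQ_D[of "\<lambda>n. ?A g (u n)" _ "r / 3"] by fastforce
  show "\<exists>no. \<forall>n\<ge>no. norm (?A h2 (u n) - (LINT x|lborel. h1 x * cnj (h2 x))) < r"
  proof (intro exI allI impI)
    fix n assume n: "n0 \<le> n"
    have "norm (?A h2 (u n) - ?A h2 0) \<le>
        norm (?A h2 (u n) - ?A g (u n)) + norm (?A g (u n) - ?A g 0) + norm (?A h2 0 - ?A g 0)"
    proof -
      have "norm (a - d) \<le> norm (a - b) + norm (b - c) + norm (d - c)" for a b c d :: complex
        using norm_triangle_ineq[of "a - b" "b - d"] norm_triangle_ineq4[of "b - c" "d - c"] by simp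
      then show ?thesis .
    qed
    also have "\<dots> < r"
      using close2[of "u n"] close2[of 0] n0[OF n] by simp
    finally show "norm (?A h2 (u n) - (LINT x|lborel. h1 x * cnj (h2 x))) < r" by simp
  qed
qed


section \<open>Plancherel's theorem\<close>

context pair_sigma_finite
begin

lemma
  fixes f :: "'a \<Rightarrow> complex" and g :: "'b \<Rightarrow> complex"
  assumes f: "integrable M1 f" and g: "integrable M2 g"
  shows integrable_mult_pair: "integrable (M1 \<Otimes>\<^sub>M M2) (\<lambda>z. f (fst z) * g (snd z))"
    and integral_mult_pair: "(LINT z|(M1 \<Otimes>\<^sub>M M2). f (fst z) * g (snd z)) =
      (LINT x|M1. f x) * (LINT y|M2. g y)"
proof -
  have [measurable]: "f \<in> borel_measurable M1" "g \<in> borel_measurable M2" using f g by auto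
  show i: "integrable (M1 \<Otimes>\<^sub>M M2) (\<lambda>z. f (fst z) * g (snd z))"
  proof (rule Fubini_integrable)
    show "integrable M1 (\<lambda>x. LINT y|M2. norm (f (fst (x, y)) * g (snd (x, y))))"
      using f g by (auto simp: norm_mult)
    show "AE x in M1. integrable M2 (\<lambda>y. f (fst (x, y)) * g (snd (x, y)))"
      using g by auto
  qed measurable
  show "(LINT z|(M1 \<Otimes>\<^sub>M M2). f (fst z) * g (snd z)) = (LINT x|M1. f x) * (LINT y|M2. g y)"
    using integral_fst'[OF i] by simp
qed

end

text \<open>Integrating over the second variable first, an affine substitution makes the inner
  integral of \<open>norm (G (x - c * y))\<close> independent of \<open>x\<close>; a constant
  multiple of \<open>norm (F x)\<close> remains.\<close>

lemma integrable_shear: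
  fixes F G :: "real \<Rightarrow> complex"
  assumes F: "integrable lborel F" and G: "integrable lborel G" and c: "c \<noteq> 0"
  shows "integrable (lborel \<Otimes>\<^sub>M lborel) (\<lambda>z. F (fst z) * G (fst z - c * snd z))"
proof (rule lborel_pair.Fubini_integrable)
  have [measurable]: "F \<in> borel_measurable borel" "G \<in> borel_measurable borel"
    using F G by auto
  show "(\<lambda>z. F (fst z) * G (fst z - c * snd z)) \<in> borel_measurable (lborel \<Otimes>\<^sub>M lborel)"
    by measurable
  have "\<bar>c\<bar> * (LINT y|lborel. norm (G (x - c * y))) = (LINT y|lborel. norm (G y))" for x
    using lborel_integral_real_affine[of "-c" "\<lambda>y. norm (G y)" x] c by simp
  then have "(LINT y|lborel. norm (G (x - c * y))) = (LINT y|lborel. norm (G y)) / \<bar>c\<bar>" for x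
    using c by (simp add: field_simps)
  then show "integrable lborel (\<lambda>x. LINT y|lborel. norm (F (fst (x, y)) * G (fst (x, y) - c * snd (x, y))))"
    using F by (simp add: norm_mult)
  show "AE x in lborel. integrable lborel (\<lambda>y. F (fst (x, y)) * G (fst (x, y) - c * snd (x, y)))"
    using lborel_integrable_real_affine[OF G, of "-c"] c by auto
qed

text \<open>Positive sign in the exponent and no normalization, as for \<open>char\<close>;
  Plancherel's identity therefore carries a factor \<open>2 * pi\<close>.\<close>

definition fourier :: "(real \<Rightarrow> complex) \<Rightarrow> real \<Rightarrow> complex" where
  "fourier h k = (LINT x|lborel. iexp (k * x) * h x)"

lemma integrable_iexp_mult:
  fixes h :: "real \<Rightarrow> complex"
  assumes "integrable lborel h"
  shows "integrable lborel (\<lambda>x. iexp (k * x) * h x)"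
  by (rule Bochner_Integration.integrable_bound[OF assms])
    (use assms in \<open>auto simp: norm_mult\<close>)

lemma borel_measurable_fourier [measurable]:
  assumes [measurable]: "h \<in> borel_measurable borel"
  shows "fourier h \<in> borel_measurable borel"
  unfolding fourier_def[abs_def] by measurable

lemma norm_fourier_le: "norm (fourier h k) \<le> (LINT x|lborel. norm (h x))"
  using integral_norm_bound[of lborel "\<lambda>x. iexp (k * x) * h x"]
  by (simp add: fourier_def norm_mult)

lemma std_normal_integrable: "integrable lborel (\<lambda>x::real. exp (- x\<^sup>2 / 2))"
  and std_normal_integral: "(LINT x|lborel. exp (- x\<^sup>2 / 2)) = sqrt (2 * pi)"
proof -
  have e: "exp (- x\<^sup>2 / 2) = sqrt (2 * pi) * std_normal_density x" for x :: real
    by (simp add: std_normal_density_def)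
  show "integrable lborel (\<lambda>x::real. exp (- x\<^sup>2 / 2))"
    unfolding e by simp
  show "(LINT x|lborel. exp (- x\<^sup>2 / 2)) = sqrt (2 * pi)"
    unfolding e by (simp add: integral_normal_density)
qed

lemma gauss_integrable:
  assumes "e \<noteq> 0"
  shows "integrable lborel (\<lambda>x::real. exp (- (e * x)\<^sup>2 / 2))"
  using lborel_integrable_real_affine[OF std_normal_integrable assms, of 0] by simp

text \<open>The left side is the characteristic function of the standard normal distribution at
  \<open>t / e\<close>, after the substitution \<open>x = e * k\<close> and up to the normalizing
  constant of the density.\<close>

lemma gauss_fourier:
  assumes "e > 0"
  shows "(LINT k|lborel. of_real (exp (- (e * k)\<^sup>2 / 2)) * iexp (k * t)) =
    of_real (sqrt (2 * pi) / e * exp (- (t / e)\<^sup>2 / 2))"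
proof -
  have "of_real (exp (- (t / e)\<^sup>2 / 2)) = char std_normal_distribution (t / e)"
    by (simp add: char_std_normal_distribution)
  also have "\<dots> = (LINT x|lborel. std_normal_density x *\<^sub>R iexp (t / e * x))"
    unfolding char_def by (subst integral_density) auto
  also have "\<dots> = e *\<^sub>R (LINT x|lborel. std_normal_density (e * x) *\<^sub>R iexp (t / e * (e * x)))"
    using lborel_integral_real_affine[of e "\<lambda>x. std_normal_density x *\<^sub>R iexp (t / e * x)" 0] assms
    by simp
  also have "(LINT x|lborel. std_normal_density (e * x) *\<^sub>R iexp (t / e * (e * x))) =
      (LINT k|lborel. of_real (1 / sqrt (2 * pi)) * (of_real (exp (- (e * k)\<^sup>2 / 2)) * iexp (k * t)))"
    using assms by (intro Bochner_Integration.integral_cong)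
      (auto simp: std_normal_density_def scaleR_conv_of_real mult_ac)
  also have "\<dots> = of_real (1 / sqrt (2 * pi)) * (LINT k|lborel. of_real (exp (- (e * k)\<^sup>2 / 2)) * iexp (k * t))"
    by (rule integral_mult_right_zero)
  finally show ?thesis using assms by (simp add: scaleR_conv_of_real field_simps)
qed

text \<open>The product of the transforms is a double integral over \<open>(x, y)\<close> with phase
  \<open>k * (x - y)\<close>. Integrating over \<open>k\<close> first turns the phase into a
  Gaussian of width \<open>e\<close> in \<open>x - y\<close>, and rescaling
  \<open>x - y = e * v\<close> moves \<open>e\<close> into the correlation.\<close>

lemma gauss_pairing:
  assumes h1: "integrable lborel h1" and h2: "integrable lborel h2" and e: "e > 0"
  shows "(LINT k|lborel. fourier h1 k * cnj (fourier h2 k) * of_real (exp (- (e * k)\<^sup>2 / 2))) =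
    of_real (sqrt (2 * pi)) *
    (LINT v|lborel. of_real (exp (- v\<^sup>2 / 2)) * (LINT x|lborel. h1 x * cnj (h2 (x - e * v))))"
proof -
  have [measurable]: "h1 \<in> borel_measurable borel" "h2 \<in> borel_measurable borel"
    using h1 h2 by auto
  let ?g = "\<lambda>k. complex_of_real (exp (- (e * k)\<^sup>2 / 2))"
  let ?K = "\<lambda>z. h1 (fst z) * cnj (h2 (snd z))"
  let ?c = "sqrt (2 * pi)"
  let ?P = "lborel \<Otimes>\<^sub>M lborel :: (real \<times> real) measure"
  interpret P: pair_sigma_finite ?P "lborel :: real measure"
    by (simp add: lborel_prod) standard
  have K: "integrable ?P ?K"
    by (rule lborel_pair.integrable_mult_pair) (use h1 h2 in auto)
  have "fourier h1 k * cnj (fourier h2 k) = (LINT z|?P. ?K z * iexp (k * (fst z - snd z)))" for k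
  proof -
    have "fourier h1 k * cnj (fourier h2 k) =
        (LINT x|lborel. iexp (k * x) * h1 x) * (LINT y|lborel. cnj (iexp (k * y) * h2 y))"
      by (simp only: fourier_def Bochner_Integration.integral_cnj)
    also have "\<dots> = (LINT z|?P. (iexp (k * fst z) * h1 (fst z)) * cnj (iexp (k * snd z) * h2 (snd z)))"
      by (rule lborel_pair.integral_mult_pair[symmetric, OF integrable_iexp_mult[OF h1]
            integrable_cnj[OF integrable_iexp_mult[OF h2]]])
    also have "\<dots> = (LINT z|?P. ?K z * iexp (k * (fst z - snd z)))"
      by (intro Bochner_Integration.integral_cong)
        (auto simp: exp_cnj right_diff_distrib exp_diff exp_minus divide_inverse mult_ac)
    finally show ?thesis .
  qed
  moreover have "(LINT z|?P. ?K z * iexp (k * (fst z - snd z))) * c =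
      (LINT z|?P. ?K z * (c * iexp (k * (fst z - snd z))))" for k c
    by (subst integral_mult_left_zero[symmetric]) (simp only: mult_ac)
  ultimately have "(LINT k|lborel. fourier h1 k * cnj (fourier h2 k) * ?g k) =
      (LINT k|lborel. LINT z|?P. ?K z * (?g k * iexp (k * (fst z - snd z))))"
    by (simp only:)
  \<comment> \<open>The phase has modulus 1, so \<open>?K\<close> times the Gaussian dominates the
    integrand. Without the Gaussian there would be no integrability in \<open>k\<close>.\<close>
  also have "\<dots> = (LINT z|?P. LINT k|lborel. ?K z * (?g k * iexp (k * (fst z - snd z))))"
  proof (rule P.Fubini_integral)
    have "integrable lborel ?g"
      using gauss_integrable[of e] e by (intro integrable_of_real) auto
    with K have "integrable (?P \<Otimes>\<^sub>M lborel) (\<lambda>w. ?K (fst w) * ?g (snd w))"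
      by (rule P.integrable_mult_pair)
    then show "integrable (?P \<Otimes>\<^sub>M lborel) (\<lambda>(z, k). ?K z * (?g k * iexp (k * (fst z - snd z))))"
      by (rule Bochner_Integration.integrable_bound) (auto simp: norm_mult)
  qed
  also have "\<dots> = (LINT z|?P. ?K z * of_real (?c / e * exp (- ((fst z - snd z) / e)\<^sup>2 / 2)))"
    by (simp only: integral_mult_right_zero gauss_fourier[OF e])
  also have "\<dots> = (LINT x|lborel. LINT y|lborel. h1 x * cnj (h2 y) * of_real (?c / e * exp (- ((x - y) / e)\<^sup>2 / 2)))"
  proof -
    have "integrable ?P (\<lambda>z. ?K z * of_real (?c / e * exp (- ((fst z - snd z) / e)\<^sup>2 / 2)))"
      by (rule Bochner_Integration.integrable_bound[OF integrable_mult_left[OF K, of "of_real (?c / e)"]])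
        (use e in \<open>auto simp: norm_mult norm_divide abs_mult
          intro!: AE_I2 mult_left_mono divide_right_mono mult_left_le\<close>)
    from lborel_pair.integral_fst'[OF this, symmetric] show ?thesis by simp
  qed
  \<comment> \<open>Substitution \<open>y = x - e * v\<close>; its Jacobian cancels the factor
    \<open>1 / e\<close>.\<close>
  also have "\<dots> = (LINT x|lborel. LINT v|lborel. of_real ?c * (h1 x * cnj (h2 (x - e * v)) * of_real (exp (- v\<^sup>2 / 2))))"
  proof (rule Bochner_Integration.integral_cong[OF refl])
    fix x
    show "(LINT y|lborel. h1 x * cnj (h2 y) * of_real (?c / e * exp (- ((x - y) / e)\<^sup>2 / 2))) =
        (LINT v|lborel. of_real ?c * (h1 x * cnj (h2 (x - e * v)) * of_real (exp (- v\<^sup>2 / 2))))"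
      using e by (subst lborel_integral_real_affine[of "-e" _ x], simp,
          subst integral_scaleR_right[symmetric])
        (auto simp: scaleR_conv_of_real mult_ac simp del: integral_mult_right_zero integral_mult_left_zero
          integral_scaleR_right integral_divide_zero intro!: Bochner_Integration.integral_cong)
  qed
  also have "\<dots> = of_real ?c * (LINT x|lborel. LINT v|lborel. h1 x * cnj (h2 (x - e * v)) * of_real (exp (- v\<^sup>2 / 2)))"
    by (simp only: integral_mult_right_zero)
  \<comment> \<open>The order is exchanged again so that the correlation becomes the inner integral;
    \<open>integrable_shear\<close> provides integrability, since the Gaussian is at most 1.\<close>
  also have "(LINT x|lborel. LINT v|lborel. h1 x * cnj (h2 (x - e * v)) * of_real (exp (- v\<^sup>2 / 2))) =
      (LINT v|lborel. LINT x|lborel. h1 x * cnj (h2 (x - e * v)) * of_real (exp (- v\<^sup>2 / 2)))"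
  proof (rule lborel_pair.Fubini_integral[symmetric])
    have "integrable ?P (\<lambda>z. h1 (fst z) * cnj (h2 (fst z - e * snd z)))"
      by (rule integrable_shear[OF h1 integrable_cnj[OF h2]]) (use e in simp)
    then show "integrable ?P (\<lambda>(x, v). h1 x * cnj (h2 (x - e * v)) * of_real (exp (- v\<^sup>2 / 2)))"
      by (rule Bochner_Integration.integrable_bound) (auto simp: norm_mult split_beta intro!: AE_I2 mult_left_le)
  qed
  also have "\<dots> = (LINT v|lborel. of_real (exp (- v\<^sup>2 / 2)) * (LINT x|lborel. h1 x * cnj (h2 (x - e * v))))"
    by (intro Bochner_Integration.integral_cong refl, subst integral_mult_left_zero) (rule mult.commute)
  finally show ?thesis .
qed

text \<open>For each \<open>v\<close> the correlation at \<open>inverse (Suc n) * v\<close> tends to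
  its value at \<open>0\<close>, and \<open>correlation_bound\<close> times the Gaussian dominates.
  One \<open>sqrt (2 * pi)\<close> comes from \<open>gauss_pairing\<close>, the other is the mass of
  the Gaussian.\<close>

lemma gauss_pairing_tendsto:
  assumes h1: "integrable lborel h1" "h1 \<in> L2 lborel" and h2: "integrable lborel h2" "h2 \<in> L2 lborel"
  shows "(\<lambda>n. LINT k|lborel. fourier h1 k * cnj (fourier h2 k) * of_real (exp (- (inverse (Suc n) * k)\<^sup>2 / 2)))
    \<longlonglongrightarrow> of_real (2 * pi) * (LINT x|lborel. h1 x * cnj (h2 x))"
proof -
  have [measurable]: "h1 \<in> borel_measurable borel" "h2 \<in> borel_measurable borel"
    using h1 h2 by auto
  let ?c = "sqrt (2 * pi)"
  let ?A = "\<lambda>u. LINT x|lborel. h1 x * cnj (h2 (x - u))"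
  let ?N = "sqrt (LINT x|lborel. (norm (h1 x))\<^sup>2) * sqrt (LINT x|lborel. (norm (h2 x))\<^sup>2)"
  have "(\<lambda>n. LINT v|lborel. of_real (exp (- v\<^sup>2 / 2)) * ?A (inverse (Suc n) * v)) \<longlonglongrightarrow>
      (LINT v|lborel. of_real (exp (- v\<^sup>2 / 2)) * ?A 0)"
  proof (rule integral_dominated_convergence)
    show "integrable lborel (\<lambda>v::real. exp (- v\<^sup>2 / 2) * ?N)"
      by (intro integrable_mult_left std_normal_integrable)
    show "AE v in lborel. (\<lambda>n. of_real (exp (- v\<^sup>2 / 2)) * ?A (inverse (Suc n) * v)) \<longlonglongrightarrow>
        of_real (exp (- v\<^sup>2 / 2)) * ?A 0"
    proof (rule AE_I2, intro tendsto_mult tendsto_const)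
      fix v :: real
      have "(\<lambda>n. inverse (real (Suc n)) * v) \<longlonglongrightarrow> 0"
        using tendsto_mult_right[OF LIMSEQ_inverse_real_of_nat, of v] by simp
      from correlation_tendsto[OF h1(2) h2(2) this] show "(\<lambda>n. ?A (inverse (Suc n) * v)) \<longlonglongrightarrow> ?A 0"
        by simp
    qed
    show "AE v in lborel. norm (of_real (exp (- v\<^sup>2 / 2)) * ?A (inverse (Suc n) * v)) \<le> exp (- v\<^sup>2 / 2) * ?N" for n
      using correlation_bound[OF h1(2) h2(2)] by (auto simp: norm_mult intro!: mult_left_mono)
  qed measurable
  also have "(LINT v|lborel. of_real (exp (- v\<^sup>2 / 2)) * ?A 0) = of_real ?c * ?A 0"
    by (subst integral_mult_left_zero, subst integral_complex_of_real, subst std_normal_integral) simp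
  finally have "(\<lambda>n. of_real ?c * (LINT v|lborel. of_real (exp (- v\<^sup>2 / 2)) * ?A (inverse (Suc n) * v))) \<longlonglongrightarrow>
      of_real ?c * (of_real ?c * ?A 0)"
    by (intro tendsto_mult tendsto_const)
  also have "of_real ?c * (of_real ?c * ?A 0) = of_real (2 * pi) * (LINT x|lborel. h1 x * cnj (h2 x))"
    by (simp only: mult.assoc[symmetric] flip: of_real_mult) simp
  finally show ?thesis
    by (subst gauss_pairing[OF h1(1) h2(1)]) simp_all
qed

text \<open>For \<open>h1 = h2 = h\<close> the regularized integrands are nonnegative and increase
  with \<open>n\<close>, because the Gaussian widens. Their integrals converge to a finite limit, so
  monotone convergence makes the unweighted square integrable.\<close>

lemma fourier_L2:
  assumes h: "integrable lborel h" "h \<in> L2 lborel"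
  shows "fourier h \<in> L2 lborel"
proof -
  have [measurable]: "h \<in> borel_measurable borel" using h by auto
  let ?e = "\<lambda>n. inverse (real (Suc n))"
  let ?f = "\<lambda>n k. (norm (fourier h k))\<^sup>2 * exp (- (?e n * k)\<^sup>2 / 2)"
  have mono: "?f m k \<le> ?f n k" if "m \<le> n" for m n k
  proof -
    have "(?e n)\<^sup>2 \<le> (?e m)\<^sup>2" using that by (intro power_mono le_imp_inverse_le) auto
    then show ?thesis by (auto simp: power_mult_distrib intro!: mult_left_mono mult_right_mono)
  qed
  \<comment> \<open>The transform of an integrable function is bounded, so a constant times the
    Gaussian dominates.\<close>
  have int: "integrable lborel (?f n)" for n
  proof (rule Bochner_Integration.integrable_bound)
    show "integrable lborel (\<lambda>k::real. (LINT x|lborel. norm (h x))\<^sup>2 * exp (- (?e n * k)\<^sup>2 / 2))"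
      by (intro integrable_mult_right gauss_integrable) simp
  qed (auto intro!: mult_right_mono power_mono norm_fourier_le)
  have "(\<lambda>n. of_real (LINT k|lborel. ?f n k)) \<longlonglongrightarrow>
      complex_of_real (2 * pi * (LINT x|lborel. (norm (h x))\<^sup>2))"
    using gauss_pairing_tendsto[OF h h]
    by (simp only: complex_norm_square[symmetric] integral_complex_of_real flip: of_real_power of_real_mult)
  then have lim: "(\<lambda>n. LINT k|lborel. ?f n k) \<longlonglongrightarrow> 2 * pi * (LINT x|lborel. (norm (h x))\<^sup>2)"
    by (simp only: tendsto_of_real_iff)
  have ptw: "(\<lambda>n. ?f n k) \<longlonglongrightarrow> (norm (fourier h k))\<^sup>2" for k
  proof -
    have "(\<lambda>n. ?f n k) \<longlonglongrightarrow> (norm (fourier h k))\<^sup>2 * exp (- (0 * k)\<^sup>2 / 2)"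
      by (intro tendsto_intros LIMSEQ_inverse_real_of_nat) auto
    then show ?thesis by simp
  qed
  have "integrable lborel (\<lambda>k. (norm (fourier h k))\<^sup>2)"
    by (rule integrable_monotone_convergence[where f = ?f and x = "2 * pi * (LINT x|lborel. (norm (h x))\<^sup>2)"])
      (use int lim ptw mono in \<open>auto simp: mono_def\<close>)
  then show "fourier h \<in> L2 lborel"
    by (simp add: L2_def)
qed

text \<open>Once \<open>fourier_L2\<close> supplies an integrable majorant, the Gaussian factor can
  also be removed by dominated convergence; the two limits of the same sequence must agree.\<close>

lemma plancherel:
  assumes h1: "integrable lborel h1" "h1 \<in> L2 lborel" and h2: "integrable lborel h2" "h2 \<in> L2 lborel"
  shows "(LINT k|lborel. fourier h1 k * cnj (fourier h2 k)) = of_real (2 * pi) * (LINT x|lborel. h1 x * cnj (h2 x))"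
proof -
  have [measurable]: "h1 \<in> borel_measurable borel" "h2 \<in> borel_measurable borel"
    using h1 h2 by auto
  let ?F = "\<lambda>k. fourier h1 k * cnj (fourier h2 k)"
  have i: "integrable lborel ?F"
    by (rule L2_mult_cnj_integrable[OF fourier_L2[OF h1] fourier_L2[OF h2]])
  have "(\<lambda>n. LINT k|lborel. ?F k * of_real (exp (- (inverse (Suc n) * k)\<^sup>2 / 2))) \<longlonglongrightarrow> (LINT k|lborel. ?F k)"
  proof (rule integral_dominated_convergence[OF _ _ integrable_norm[OF i]])
    show "AE k in lborel. (\<lambda>n. ?F k * of_real (exp (- (inverse (Suc n) * k)\<^sup>2 / 2))) \<longlonglongrightarrow> ?F k"
    proof (rule AE_I2)
      fix k :: real
      have "(\<lambda>n. ?F k * of_real (exp (- (inverse (real (Suc n)) * k)\<^sup>2 / 2))) \<longlonglongrightarrow>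
          ?F k * of_real (exp (- (0 * k)\<^sup>2 / 2))"
        by (intro tendsto_intros LIMSEQ_inverse_real_of_nat) auto
      then show "(\<lambda>n. ?F k * of_real (exp (- (inverse (Suc n) * k)\<^sup>2 / 2))) \<longlonglongrightarrow> ?F k"
        by simp
    qed
  qed (auto simp: norm_mult split_beta intro!: AE_I2 mult_left_le)
  from LIMSEQ_unique[OF this gauss_pairing_tendsto[OF h1 h2]] show ?thesis .
qed


section \<open>The Moyal identity for the complex transform\<close>

definition shift_prod :: "(real \<Rightarrow> complex) \<Rightarrow> (real \<Rightarrow> complex) \<Rightarrow> real \<Rightarrow> real \<Rightarrow> complex" where
  "shift_prod f g p x = f x * cnj (g (x - p))"

lemma shift_prod_integrable:
  assumes "f \<in> L2 lborel" "g \<in> L2 lborel"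
  shows "integrable lborel (shift_prod f g p)"
  unfolding shift_prod_def using L2_mult_cnj_integrable[OF assms(1) L2_shift[OF assms(2)]] by simp

lemma shift_prod_norm_integrable:
  assumes "f \<in> L2 lborel" "g \<in> L2 lborel"
  shows "integrable (lborel \<Otimes>\<^sub>M lborel) (\<lambda>(x, p). (norm (shift_prod f g p x))\<^sup>2)"
proof -
  let ?F = "\<lambda>x. complex_of_real ((norm (f x))\<^sup>2)" and ?G = "\<lambda>x. complex_of_real ((norm (g x))\<^sup>2)"
  have "integrable (lborel \<Otimes>\<^sub>M lborel) (\<lambda>z. ?F (fst z) * ?G (fst z - 1 * snd z))"
    by (rule integrable_shear) (use L2D(2)[OF assms(1)] L2D(2)[OF assms(2)] in \<open>auto simp del: of_real_power\<close>)
  then have "integrable (lborel \<Otimes>\<^sub>M lborel) (\<lambda>z. norm (?F (fst z) * ?G (fst z - 1 * snd z)))"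
    by (rule integrable_norm)
  then show ?thesis
    by (simp add: shift_prod_def norm_mult power_mult_distrib case_prod_unfold norm_power)
qed

text \<open>A product of two square integrable functions is integrable for every shift, but its
  square integrability comes only from sections of a jointly integrable function, hence for almost
  every \<open>p\<close>.\<close>

lemma shift_prod_L2_AE:
  assumes "f \<in> L2 lborel" "g \<in> L2 lborel"
  shows "AE p in lborel. shift_prod f g p \<in> L2 lborel"
  using lborel_pair.AE_integrable_snd[OF shift_prod_norm_integrable[OF assms]]
proof eventually_elim
  case (elim p)
  with borel_measurable_integrable[OF shift_prod_integrable[OF assms]] show ?case
    by (simp add: L2_def)
qed

text \<open>Since \<open>\<tau> = \<i> * Im \<tau>\<close>, the exponent splits into a part free of
  \<open>x\<close>, which becomes the phase, and a Fourier kernel whose frequency carries the sign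
  \<open>Im \<tau>\<close>.\<close>

lemma FW_eq_fourier:
  assumes "\<tau> \<in> {\<i>, -\<i>}" and [measurable]: "f \<in> borel_measurable borel" "g \<in> borel_measurable borel"
  shows "FW \<sigma> \<tau> f g (of_real p + \<tau> * of_real q) =
    of_real (sqrt (\<sigma> / (2 * pi))) * iexp (- (Im \<tau> * \<sigma> * p * q / 2)) *
      fourier (shift_prod f g p) (Im \<tau> * \<sigma> * q)"
proof -
  have "FW \<sigma> \<tau> f g (of_real p + \<tau> * of_real q) = of_real (sqrt (\<sigma> / (2 * pi))) *
      (LINT x|lborel. exp (\<tau> * of_real (\<sigma> * (x - p / 2) * q)) * f x * cnj (g (x - p)))"
    unfolding FW_eq[OF assms(1)] by (subst integral_completion) auto
  also have "(LINT x|lborel. exp (\<tau> * of_real (\<sigma> * (x - p / 2) * q)) * f x * cnj (g (x - p))) =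
      (LINT x|lborel. iexp (- (Im \<tau> * \<sigma> * p * q / 2)) * (iexp (Im \<tau> * \<sigma> * q * x) * shift_prod f g p x))"
  proof (rule Bochner_Integration.integral_cong[OF refl])
    fix x
    have "\<tau> * of_real (\<sigma> * (x - p / 2) * q) =
        \<i> * of_real (- (Im \<tau> * \<sigma> * p * q / 2)) + \<i> * of_real (Im \<tau> * \<sigma> * q * x)"
      using assms(1) by (auto simp: algebra_simps)
    then show "exp (\<tau> * of_real (\<sigma> * (x - p / 2) * q)) * f x * cnj (g (x - p)) =
        iexp (- (Im \<tau> * \<sigma> * p * q / 2)) * (iexp (Im \<tau> * \<sigma> * q * x) * shift_prod f g p x)"
      by (simp only: exp_add shift_prod_def mult_ac)
  qed
  also have "\<dots> = iexp (- (Im \<tau> * \<sigma> * p * q / 2)) * fourier (shift_prod f g p) (Im \<tau> * \<sigma> * q)"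
    unfolding fourier_def by (rule integral_mult_right_zero)
  finally show ?thesis by (simp only: mult.assoc)
qed

text \<open>The transform as a function of the real pair \<open>(p, q)\<close>, so that it lives on
  a product measure whichever sign \<open>\<tau>\<close> has.\<close>

definition FW_real :: "real \<Rightarrow> complex \<Rightarrow> (real \<Rightarrow> complex) \<Rightarrow> (real \<Rightarrow> complex) \<Rightarrow> real \<times> real \<Rightarrow> complex" where
  "FW_real \<sigma> \<tau> f g z = FW \<sigma> \<tau> f g (of_real (fst z) + \<tau> * of_real (snd z))"

context
  fixes \<sigma> :: real and \<tau> :: complex
  assumes \<sigma>: "\<sigma> > 0" and \<tau>: "\<tau> \<in> {\<i>, -\<i>}"
begin

lemma Im_unit: "\<bar>Im \<tau>\<bar> = 1" "Im \<tau> \<noteq> 0"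
  using \<tau> by auto

lemma borel_measurable_FW_real [measurable]:
  assumes [measurable]: "f \<in> borel_measurable borel" "g \<in> borel_measurable borel"
  shows "FW_real \<sigma> \<tau> f g \<in> borel_measurable (lborel \<Otimes>\<^sub>M lborel)"
  unfolding FW_real_def[abs_def] FW_eq_fourier[OF \<tau> assms] fourier_def shift_prod_def
  by measurable

text \<open>The phase depends on \<open>p\<close> and \<open>q\<close> but not on the functions, so
  it cancels against its conjugate. The summand \<open>0\<close> in the frequency gives it the shape
  of the affine substitution rules.\<close>

lemma FW_real_mult_cnj:
  assumes "f1 \<in> borel_measurable borel" "g1 \<in> borel_measurable borel"
    "f2 \<in> borel_measurable borel" "g2 \<in> borel_measurable borel"
  shows "FW_real \<sigma> \<tau> f1 g1 (p, q) * cnj (FW_real \<sigma> \<tau> f2 g2 (p, q)) =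
    of_real (\<sigma> / (2 * pi)) * (fourier (shift_prod f1 g1 p) (0 + (Im \<tau> * \<sigma>) * q) *
      cnj (fourier (shift_prod f2 g2 p) (0 + (Im \<tau> * \<sigma>) * q)))"
proof -
  have 1: "complex_of_real (sqrt (\<sigma> / (2 * pi))) * of_real (sqrt (\<sigma> / (2 * pi))) = of_real (\<sigma> / (2 * pi))"
    using \<sigma> by (simp only: flip: of_real_mult) simp
  have 2: "iexp x * cnj (iexp x) = 1" for x
    by (simp add: exp_cnj flip: exp_add)
  have "(a * e * F) * cnj (a * e * G) = (a * cnj a) * (e * cnj e) * (F * cnj G)" for a e F G :: complex
    by simp
  then show ?thesis
    unfolding FW_real_def fst_conv snd_conv FW_eq_fourier[OF \<tau> assms(1,2)] FW_eq_fourier[OF \<tau> assms(3,4)]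
    by (simp only: 2 complex_cnj_complex_of_real 1) simp
qed

text \<open>Plancherel after the substitution \<open>k = Im \<tau> * \<sigma> * q\<close>: the
  Jacobian is \<open>\<sigma>\<close>, which together with \<open>2 * pi\<close> from Plancherel
  cancels the prefactor \<open>\<sigma> / (2 * pi)\<close>.\<close>

lemma FW_real_fiber:
  assumes f1: "f1 \<in> borel_measurable borel" and g1: "g1 \<in> borel_measurable borel"
    and f2: "f2 \<in> borel_measurable borel" and g2: "g2 \<in> borel_measurable borel"
    and h1: "integrable lborel (shift_prod f1 g1 p)" "shift_prod f1 g1 p \<in> L2 lborel"
    and h2: "integrable lborel (shift_prod f2 g2 p)" "shift_prod f2 g2 p \<in> L2 lborel"
  shows "integrable lborel (\<lambda>q. FW_real \<sigma> \<tau> f1 g1 (p, q) * cnj (FW_real \<sigma> \<tau> f2 g2 (p, q)))"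
    and "(LINT q|lborel. FW_real \<sigma> \<tau> f1 g1 (p, q) * cnj (FW_real \<sigma> \<tau> f2 g2 (p, q))) =
      (LINT x|lborel. shift_prod f1 g1 p x * cnj (shift_prod f2 g2 p x))"
proof -
  let ?P = "\<lambda>k. fourier (shift_prod f1 g1 p) k * cnj (fourier (shift_prod f2 g2 p) k)"
  let ?c = "Im \<tau> * \<sigma>"
  have c: "?c \<noteq> 0" "\<bar>?c\<bar> = \<sigma>" using \<sigma> Im_unit by (auto simp: abs_mult)
  have P: "integrable lborel ?P"
    by (rule L2_mult_cnj_integrable[OF fourier_L2[OF h1] fourier_L2[OF h2]])
  note eq = FW_real_mult_cnj[OF f1 g1 f2 g2]
  show "integrable lborel (\<lambda>q. FW_real \<sigma> \<tau> f1 g1 (p, q) * cnj (FW_real \<sigma> \<tau> f2 g2 (p, q)))"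
    unfolding eq by (intro integrable_mult_right lborel_integrable_real_affine[OF P c(1)])
  have "(LINT q|lborel. FW_real \<sigma> \<tau> f1 g1 (p, q) * cnj (FW_real \<sigma> \<tau> f2 g2 (p, q))) =
      of_real (\<sigma> / (2 * pi)) * (LINT q|lborel. ?P (0 + ?c * q))"
    unfolding eq by (rule integral_mult_right_zero)
  also have "\<dots> = of_real (1 / (2 * pi)) * (\<bar>?c\<bar> *\<^sub>R (LINT q|lborel. ?P (0 + ?c * q)))"
    unfolding c(2) by (simp add: scaleR_conv_of_real)
  also have "\<dots> = of_real (1 / (2 * pi)) * (LINT k|lborel. ?P k)"
    by (simp only: lborel_integral_real_affine[OF c(1), of ?P 0, symmetric])
  also have "\<dots> = (LINT x|lborel. shift_prod f1 g1 p x * cnj (shift_prod f2 g2 p x))"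
    unfolding plancherel[OF h1 h2] by simp
  finally show "(LINT q|lborel. FW_real \<sigma> \<tau> f1 g1 (p, q) * cnj (FW_real \<sigma> \<tau> f2 g2 (p, q))) =
      (LINT x|lborel. shift_prod f1 g1 p x * cnj (shift_prod f2 g2 p x))" .
qed

text \<open>By the fibre identity with equal arguments, the integral over \<open>q\<close> of the
  squared modulus is that of \<open>shift_prod f g p\<close> for almost every \<open>p\<close>, and
  the latter is integrable in \<open>p\<close>.\<close>

lemma FW_real_L2:
  assumes f: "f \<in> L2 lborel" and g: "g \<in> L2 lborel"
  shows "FW_real \<sigma> \<tau> f g \<in> L2 (lborel \<Otimes>\<^sub>M lborel)"
proof -
  have [measurable]: "f \<in> borel_measurable borel" "g \<in> borel_measurable borel"
    using f g by (auto simp: L2_def)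
  note fiber = FW_real_fiber[of f g f g, OF _ _ _ _ shift_prod_integrable[OF f g] _ shift_prod_integrable[OF f g]]
  note AE = shift_prod_L2_AE[OF f g]
  let ?N = "\<lambda>z. (norm (FW_real \<sigma> \<tau> f g z))\<^sup>2"
  have "integrable (lborel \<Otimes>\<^sub>M lborel) ?N"
  proof (rule lborel_pair.Fubini_integrable)
    show "AE p in lborel. integrable lborel (\<lambda>q. ?N (p, q))"
      using AE
    proof eventually_elim
      case (elim p)
      from fiber(1)[OF _ _ _ _ elim elim]
      have "integrable lborel (\<lambda>q. complex_of_real (?N (p, q)))"
        by (simp flip: complex_norm_square of_real_power)
      then show ?case
        by (simp only: complex_of_real_integrable_eq)
    qed
    have "AE p in lborel. (LINT q|lborel. norm (?N (p, q))) = (LINT x|lborel. (norm (shift_prod f g p x))\<^sup>2)"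
      using AE
    proof eventually_elim
      case (elim p)
      from fiber(2)[OF _ _ _ _ elim elim]
      have "complex_of_real (LINT q|lborel. norm (?N (p, q))) = of_real (LINT x|lborel. (norm (shift_prod f g p x))\<^sup>2)"
        by (simp flip: complex_norm_square of_real_power)
      then show ?case by (simp only: of_real_eq_iff)
    qed
    moreover have "integrable lborel (\<lambda>p. LINT x|lborel. (norm (shift_prod f g p x))\<^sup>2)"
      using lborel_pair.integrable_snd[OF shift_prod_norm_integrable[OF f g]] .
    ultimately show "integrable lborel (\<lambda>p. LINT q|lborel. norm (?N (p, q)))"
      by (subst integrable_cong_AE) (auto simp: shift_prod_def)
  qed measurable
  then show ?thesis by (simp add: L2_def)
qed

theorem FW_real_moyal:
  assumes f1: "f1 \<in> L2 lborel" and g1: "g1 \<in> L2 lborel" and f2: "f2 \<in> L2 lborel" and g2: "g2 \<in> L2 lborel"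
  shows "(LINT z|(lborel \<Otimes>\<^sub>M lborel). FW_real \<sigma> \<tau> f1 g1 z * cnj (FW_real \<sigma> \<tau> f2 g2 z)) =
    (LINT x|lborel. f1 x * cnj (f2 x)) * cnj (LINT x|lborel. g1 x * cnj (g2 x))"
proof -
  have [measurable]: "f1 \<in> borel_measurable borel" "g1 \<in> borel_measurable borel"
    "f2 \<in> borel_measurable borel" "g2 \<in> borel_measurable borel"
    using assms by (auto simp: L2_def)
  let ?F = "\<lambda>x. f1 x * cnj (f2 x)" and ?G = "\<lambda>x. cnj (g1 x * cnj (g2 x))"
  have F: "integrable lborel ?F" and G: "integrable lborel ?G"
    using L2_mult_cnj_integrable[OF f1 f2] integrable_cnj[OF L2_mult_cnj_integrable[OF g1 g2]] by simp_all
  have i: "integrable (lborel \<Otimes>\<^sub>M lborel) (\<lambda>z. FW_real \<sigma> \<tau> f1 g1 z * cnj (FW_real \<sigma> \<tau> f2 g2 z))"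
    by (intro L2_mult_cnj_integrable FW_real_L2 assms)
  have "(LINT z|(lborel \<Otimes>\<^sub>M lborel). FW_real \<sigma> \<tau> f1 g1 z * cnj (FW_real \<sigma> \<tau> f2 g2 z)) =
      (LINT p|lborel. LINT q|lborel. FW_real \<sigma> \<tau> f1 g1 (p, q) * cnj (FW_real \<sigma> \<tau> f2 g2 (p, q)))"
    by (rule lborel_pair.integral_fst'[OF i, symmetric])
  \<comment> \<open>The fibre identity holds where both shifted products are square integrable;
    rearranging their product separates the \<open>f\<close> factors from the \<open>g\<close>
    factors.\<close>
  also have "\<dots> = (LINT p|lborel. LINT x|lborel. ?F x * ?G (x - p))"
  proof (rule integral_cong_AE)
    show "AE p in lborel. (LINT q|lborel. FW_real \<sigma> \<tau> f1 g1 (p, q) * cnj (FW_real \<sigma> \<tau> f2 g2 (p, q))) =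
        (LINT x|lborel. ?F x * ?G (x - p))"
      using shift_prod_L2_AE[OF f1 g1] shift_prod_L2_AE[OF f2 g2]
    proof eventually_elim
      case (elim p)
      show ?case
        by (subst FW_real_fiber(2)[OF _ _ _ _ shift_prod_integrable[OF f1 g1] elim(1)
              shift_prod_integrable[OF f2 g2] elim(2)])
          (simp_all add: shift_prod_def mult_ac)
    qed
  qed measurable
  also have "\<dots> = (LINT x|lborel. LINT p|lborel. ?F x * ?G (x - p))"
  proof (rule lborel_pair.Fubini_integral)
    show "integrable (lborel \<Otimes>\<^sub>M lborel) (\<lambda>(x, p). ?F x * ?G (x - p))"
      using integrable_shear[OF F G, of 1] by (simp add: case_prod_unfold)
  qed
  \<comment> \<open>For fixed \<open>x\<close> the substitution \<open>y = x - p\<close> removes the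
    dependence on \<open>x\<close> from the inner integral.\<close>
  also have "\<dots> = (LINT x|lborel. ?F x * (LINT y|lborel. ?G y))"
    using lborel_integral_real_affine[of "-1" ?G] by simp
  also have "\<dots> = (LINT x|lborel. ?F x) * (LINT y|lborel. ?G y)"
    by (rule integral_mult_left_zero)
  also have "(LINT y|lborel. ?G y) = cnj (LINT x|lborel. g1 x * cnj (g2 x))"
    by (rule Bochner_Integration.integral_cnj)
  finally show ?thesis .
qed

end


section \<open>The bicomplex transform\<close>

context pair_sigma_finite
begin

lemma L2_mult_pair:
  assumes "f \<in> L2 M1" "g \<in> L2 M2"
  shows "(\<lambda>z. f (fst z) * g (snd z)) \<in> L2 (M1 \<Otimes>\<^sub>M M2)"
proof -
  note [measurable] = L2D(1)[OF assms(1)] L2D(1)[OF assms(2)]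
  have "integrable (M1 \<Otimes>\<^sub>M M2) (\<lambda>z. complex_of_real ((norm (f (fst z)))\<^sup>2) * of_real ((norm (g (snd z)))\<^sup>2))"
    by (rule integrable_mult_pair)
      (simp_all only: complex_of_real_integrable_eq L2D(2)[OF assms(1)] L2D(2)[OF assms(2)])
  then have "integrable (M1 \<Otimes>\<^sub>M M2) (\<lambda>z. (norm (f (fst z) * g (snd z)))\<^sup>2)"
    by (simp only: complex_of_real_integrable_eq norm_mult power_mult_distrib flip: of_real_mult)
  then show ?thesis by (simp add: L2_def)
qed

lemma L2_inner_mult_pair:
  assumes "f1 \<in> L2 M1" "g1 \<in> L2 M2" "f2 \<in> L2 M1" "g2 \<in> L2 M2"
  shows "(LINT z|(M1 \<Otimes>\<^sub>M M2). f1 (fst z) * g1 (snd z) * cnj (f2 (fst z) * g2 (snd z))) =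
    (LINT x|M1. f1 x * cnj (f2 x)) * (LINT y|M2. g1 y * cnj (g2 y))"
  using integral_mult_pair[OF L2_mult_cnj_integrable[OF assms(1,3)] L2_mult_cnj_integrable[OF assms(2,4)]]
  by (simp add: mult_ac)

end

section \<open>Idempotent components of bicomplex-valued integrals\<close>

lemma bicomplex_eqI:
  assumes "cplus Z = cplus W" "cminus Z = cminus W"
  shows "Z = W"
  using assms idempotent_decomposition by metis

lemma cplus_simps [simp]:
  "cplus e_plus = 1" "cplus e_minus = 0" "cplus (bc_of_complex a) = a" "cplus (of_real r) = of_real r"
  "cplus (r *\<^sub>R Z) = of_real r * cplus Z" "cplus (Z + W) = cplus Z + cplus W"
  "cplus (- Z) = - cplus Z" "cplus (Z - W) = cplus Z - cplus W" "cplus (Z * W) = cplus Z * cplus W"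
  "cplus (Z\<^sup>2) = (cplus Z)\<^sup>2" "cplus (bc_cnj Z) = cnj (cplus Z)" "cplus (bc_exp Z) = exp (cplus Z)"
  and cminus_simps [simp]:
  "cminus e_plus = 0" "cminus e_minus = 1" "cminus (bc_of_complex a) = a" "cminus (of_real r) = of_real r"
  "cminus (r *\<^sub>R Z) = of_real r * cminus Z" "cminus (Z + W) = cminus Z + cminus W"
  "cminus (- Z) = - cminus Z" "cminus (Z - W) = cminus Z - cminus W" "cminus (Z * W) = cminus Z * cminus W"
  "cminus (Z\<^sup>2) = (cminus Z)\<^sup>2" "cminus (bc_cnj Z) = cnj (cminus Z)" "cminus (bc_exp Z) = exp (cminus Z)"
proof -
  show "cplus (bc_exp Z) = exp (cplus Z)" "cminus (bc_exp Z) = exp (cminus Z)"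
    using idempotent_decomposition[of "bc_exp Z" "exp (cplus Z)" "exp (cminus Z)"]
    by (simp_all add: bc_exp_def)
qed (auto simp: cplus_def cminus_def e_plus_def e_minus_def bc_i_def bc_j_def bc_of_complex_def bc_cnj_def
      power2_eq_square scaleR_conv_of_real complex_eq_iff algebra_simps)

text \<open>Linearity on a finite-dimensional space gives boundedness, which lets Bochner integrals
  commute with these maps.\<close>

lemma bounded_linear_components:
  "bounded_linear cplus" "bounded_linear cminus"
  "bounded_linear (\<lambda>a. bc_of_complex a * e_plus)" "bounded_linear (\<lambda>a. bc_of_complex a * e_minus)"
  unfolding linear_conv_bounded_linear[symmetric]
  by (auto intro!: linearI bicomplex_eqI simp: scaleR_conv_of_real)

lemma integrable_bicomplex_iff:
  "integrable M F \<longleftrightarrow> integrable M (\<lambda>x. cplus (F x)) \<and> integrable M (\<lambda>x. cminus (F x))"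
proof safe
  assume "integrable M (\<lambda>x. cplus (F x))" "integrable M (\<lambda>x. cminus (F x))"
  then have "integrable M (\<lambda>x. bc_of_complex (cplus (F x)) * e_plus + bc_of_complex (cminus (F x)) * e_minus)"
    by (intro Bochner_Integration.integrable_add integrable_bounded_linear[OF bounded_linear_components(3)]
        integrable_bounded_linear[OF bounded_linear_components(4)])
  also have "(\<lambda>x. bc_of_complex (cplus (F x)) * e_plus + bc_of_complex (cminus (F x)) * e_minus) = F"
    by (auto intro!: bicomplex_eqI)
  finally show "integrable M F" .
qed (auto intro: integrable_bounded_linear[OF bounded_linear_components(1)]
      integrable_bounded_linear[OF bounded_linear_components(2)])

lemma
  assumes "integrable M F"
  shows cplus_integral: "cplus (LINT x|M. F x) = (LINT x|M. cplus (F x))"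
    and cminus_integral: "cminus (LINT x|M. F x) = (LINT x|M. cminus (F x))"
  using integral_bounded_linear[OF bounded_linear_components(1) assms]
    integral_bounded_linear[OF bounded_linear_components(2) assms] by simp_all

lemma L2_bcD:
  assumes "f \<in> L2_bc M"
  shows "(\<lambda>x. cplus (f x)) \<in> L2 M" "(\<lambda>x. cminus (f x)) \<in> L2 M"
  using assms by (auto simp: L2_bc_def)

lemma
  assumes f: "f \<in> L2_bc M" and g: "g \<in> L2_bc M"
  shows cplus_bc_inner: "cplus (bc_inner M f g) = (LINT x|M. cplus (f x) * cnj (cplus (g x)))"
    and cminus_bc_inner: "cminus (bc_inner M f g) = (LINT x|M. cminus (f x) * cnj (cminus (g x)))"
proof -
  have "integrable M (\<lambda>x. f x * bc_cnj (g x))"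
    using L2_mult_cnj_integrable[OF L2_bcD(1)[OF f] L2_bcD(1)[OF g]]
      L2_mult_cnj_integrable[OF L2_bcD(2)[OF f] L2_bcD(2)[OF g]]
    by (simp add: integrable_bicomplex_iff)
  then show "cplus (bc_inner M f g) = (LINT x|M. cplus (f x) * cnj (cplus (g x)))"
    "cminus (bc_inner M f g) = (LINT x|M. cminus (f x) * cnj (cminus (g x)))"
    by (simp_all add: bc_inner_def cplus_integral cminus_integral)
qed

section \<open>Borel representatives of Lebesgue measurable functions\<close>

lemma AE_lebesgue_shift:
  fixes p :: real
  assumes "AE x in lebesgue. P x"
  shows "AE x in lebesgue. P (x - p)"
proof -
  have "AE x in distr lborel borel ((+) (- p)). P x"
    using assms unfolding AE_completion_iff lborel_distr_plus .
  then have "AE x in lborel. P (- p + x)"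
    by (rule AE_distrD[rotated]) simp
  then show ?thesis by (simp add: AE_completion_iff)
qed

lemma borel_measurable_lebesgue_shift:
  fixes f :: "real \<Rightarrow> complex"
  assumes "f \<in> borel_measurable lebesgue"
  shows "(\<lambda>x. f (x - p)) \<in> borel_measurable lebesgue"
proof -
  have "(+) (- p) \<in> lebesgue \<rightarrow>\<^sub>M lebesgue"
    using lebesgue_affine_measurable[where c = "\<lambda>x::real. 1"] by simp
  from measurable_compose[OF this assms] show ?thesis by simp
qed

lemma L2_lebesgue_borel:
  fixes f :: "real \<Rightarrow> complex"
  assumes "f \<in> L2 lebesgue"
  obtains f' where "f' \<in> L2 lborel" "AE x in lebesgue. f x = f' x"
proof -
  have m: "f \<in> borel_measurable lebesgue" and i: "integrable lebesgue (\<lambda>x. (norm (f x))\<^sup>2)"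
    using L2D[OF assms] by auto
  have "(\<lambda>x. Re (f x)) \<in> borel_measurable lebesgue" "(\<lambda>x. Im (f x)) \<in> borel_measurable lebesgue"
    using m by auto
  from this[THEN completion_ex_borel_measurable_real]
  obtain u v where [measurable]: "u \<in> borel_measurable lborel" "v \<in> borel_measurable lborel"
    and uv: "AE x in lborel. Re (f x) = u x" "AE x in lborel. Im (f x) = v x" by blast
  define f' where "f' x = Complex (u x) (v x)" for x
  have [measurable]: "f' \<in> borel_measurable borel"
    unfolding borel_measurable_complex_iff f'_def by simp
  have ae: "AE x in lebesgue. f x = f' x"
    unfolding AE_completion_iff using uv by eventually_elim (simp add: f'_def complex_eq_iff)
  have "integrable lebesgue (\<lambda>x. (norm (f' x))\<^sup>2)"
  proof (rule integrable_cong_AE_imp[OF i])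
    show "(\<lambda>x. (norm (f' x))\<^sup>2) \<in> borel_measurable lebesgue"
      by (rule measurable_completion) measurable
    show "AE x in lebesgue. (norm (f x))\<^sup>2 = (norm (f' x))\<^sup>2"
      using ae by eventually_elim simp
  qed
  then have "f' \<in> L2 lborel"
    by (simp add: L2_def integrable_completion)
  with ae show thesis by (rule that[rotated])
qed

text \<open>Translations preserve null sets, so the shifted factor may be replaced as well. The
  factor \<open>k\<close> covers the kernel of the transform, and \<open>k = 1\<close> with
  \<open>p = 0\<close> covers inner products.\<close>

lemma integral_lebesgue_cong_borel:
  fixes f f' g g' :: "real \<Rightarrow> complex"
  assumes f: "f \<in> borel_measurable lebesgue" and f': "f' \<in> borel_measurable borel" and ff: "AE x in lebesgue. f x = f' x"
    and g: "g \<in> borel_measurable lebesgue" and g': "g' \<in> borel_measurable borel" and gg: "AE x in lebesgue. g x = g' x"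
    and k: "k \<in> borel_measurable borel"
  shows "(LINT x|lebesgue. k x * f x * cnj (g (x - p))) = (LINT x|lborel. k x * f' x * cnj (g' (x - p)))"
    and "integrable lebesgue (\<lambda>x. k x * f x * cnj (g (x - p))) \<longleftrightarrow>
      integrable lborel (\<lambda>x. k x * f' x * cnj (g' (x - p)))"
proof -
  note [measurable] = f' g' k
  have k': "k \<in> borel_measurable lebesgue"
    by (rule measurable_completion) simp
  have b: "(\<lambda>x. k x * f' x * cnj (g' (x - p))) \<in> borel_measurable lborel"
    by measurable
  have m: "(\<lambda>x. k x * f x * cnj (g (x - p))) \<in> borel_measurable lebesgue"
    using f k' borel_measurable_lebesgue_shift[OF g, of p] by measurable
  have ae: "AE x in lebesgue. k x * f x * cnj (g (x - p)) = k x * f' x * cnj (g' (x - p))"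
    using ff AE_lebesgue_shift[OF gg, of p] by eventually_elim simp
  show "(LINT x|lebesgue. k x * f x * cnj (g (x - p))) = (LINT x|lborel. k x * f' x * cnj (g' (x - p)))"
    unfolding integral_completion[OF b, symmetric]
    by (rule integral_cong_AE[OF m measurable_completion[OF b] ae])
  show "integrable lebesgue (\<lambda>x. k x * f x * cnj (g (x - p))) \<longleftrightarrow>
      integrable lborel (\<lambda>x. k x * f' x * cnj (g' (x - p)))"
    unfolding integrable_completion[OF b, symmetric]
    by (rule integrable_cong_AE[OF m measurable_completion[OF b] ae])
qed

lemma FW_cong_borel:
  assumes "f \<in> L2 lebesgue" "f' \<in> L2 lborel" "AE x in lebesgue. f x = f' x"
    "g \<in> L2 lebesgue" "g' \<in> L2 lborel" "AE x in lebesgue. g x = g' x"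
  shows "FW \<sigma> \<tau> f g w = FW \<sigma> \<tau> f' g' w"
proof -
  have m: "f \<in> borel_measurable lebesgue" "f' \<in> borel_measurable borel"
    "g \<in> borel_measurable lebesgue" "g' \<in> borel_measurable borel"
    using assms by (auto simp: L2_def)
  have k: "(\<lambda>x. exp (\<tau> * of_real (\<sigma> * (x - Re w / 2) * (Im w / Im \<tau>)))) \<in> borel_measurable borel"
    by measurable
  have m': "f' \<in> borel_measurable lebesgue" "g' \<in> borel_measurable lebesgue"
    using m by (auto intro: measurable_completion)
  show ?thesis
    unfolding FW_def Let_def
    \<comment> \<open>Both sides reduce to the same integral over \<open>lborel\<close>: first
      \<open>f\<close>, \<open>g\<close> are replaced by their representatives, then the
      representatives by themselves.\<close>
    by (rule arg_cong[where f = "(*) _"], rule trans,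
        rule integral_lebesgue_cong_borel(1)[OF m(1,2) assms(3) m(3,4) assms(6) k],
        rule integral_lebesgue_cong_borel(1)[OF m'(1) m(2) AE_I2 m'(2) m(4) AE_I2 k, symmetric])
      (rule refl)+
qed

text \<open>Needed to take components inside the bicomplex integral. As \<open>\<tau>\<close> is
  purely imaginary the kernel has modulus 1, and a product of two square integrable functions
  remains.\<close>

lemma FW_integrand_integrable:
  assumes f: "f \<in> L2 lebesgue" and g: "g \<in> L2 lebesgue" and \<tau>: "\<tau> \<in> {\<i>, -\<i>}"
  shows "integrable lebesgue (\<lambda>x. exp (\<tau> * of_real (\<sigma> * (x - p / 2) * q)) * f x * cnj (g (x - p)))"
proof -
  obtain f' where f': "f' \<in> L2 lborel" "AE x in lebesgue. f x = f' x" using L2_lebesgue_borel[OF f] .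
  obtain g' where g': "g' \<in> L2 lborel" "AE x in lebesgue. g x = g' x" using L2_lebesgue_borel[OF g] .
  have m: "f \<in> borel_measurable lebesgue" and [measurable]: "f' \<in> borel_measurable borel"
    and mg: "g \<in> borel_measurable lebesgue" and [measurable]: "g' \<in> borel_measurable borel"
    using f f' g g' by (auto simp: L2_def)
  let ?k = "\<lambda>x. exp (\<tau> * of_real (\<sigma> * (x - p / 2) * q))"
  have "Re \<tau> = 0"
    using \<tau> by auto
  moreover have "integrable lborel (\<lambda>x. f' x * cnj (g' (x - p)))"
    using shift_prod_integrable[OF f'(1) g'(1), of p] unfolding shift_prod_def[abs_def] .
  ultimately have "integrable lborel (\<lambda>x. ?k x * f' x * cnj (g' (x - p)))"
    by (elim Bochner_Integration.integrable_bound) (auto simp: norm_mult)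
  then show ?thesis
    by (subst integral_lebesgue_cong_borel(2)[OF m _ f'(2) mg _ g'(2)]) auto
qed

text \<open>The squared norm \<open>4\<close> of the weight compensates the factor \<open>1/4\<close> in \<^const>\<open>bc_measure\<close>.\<close>

definition bc_weight :: "real \<Rightarrow> real \<times> real \<Rightarrow> complex" where
  "bc_weight \<sigma> z = of_real (sqrt (2 * \<sigma> / pi) * exp (- \<sigma> / 4 * ((fst z)\<^sup>2 + (snd z)\<^sup>2)))"

text \<open>The weight is a product of two Gaussians whose squares have mass
  \<open>sqrt (2 * pi) / sqrt \<sigma>\<close> each; thus the total is
  \<open>(2 * \<sigma> / pi) * (2 * pi / \<sigma>) = 4\<close>.\<close>

lemma bc_weight_inner:
  assumes "\<sigma> > 0"
  shows "bc_weight \<sigma> \<in> L2 (lborel \<Otimes>\<^sub>M lborel)"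
    and "(LINT z|(lborel \<Otimes>\<^sub>M lborel). bc_weight \<sigma> z * cnj (bc_weight \<sigma> z)) = 4"
proof -
  let ?g = "\<lambda>x::real. complex_of_real (exp (- \<sigma> / 4 * x\<^sup>2))"
  have sq: "(norm (?g x))\<^sup>2 = exp (- (sqrt \<sigma> * x)\<^sup>2 / 2)" for x
    using assms by (simp add: power_mult_distrib flip: exp_double)
  have "integrable lborel (\<lambda>x::real. exp (- (sqrt \<sigma> * x)\<^sup>2 / 2))"
    by (rule gauss_integrable) (use assms in simp)
  then have g: "?g \<in> L2 lborel"
    unfolding L2_def mem_Collect_eq sq by simp
  let ?c = "complex_of_real (sqrt (2 * \<sigma> / pi))"
  have w: "bc_weight \<sigma> z = ?c * (?g (fst z) * ?g (snd z))" for z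
    by (simp add: bc_weight_def ring_distribs flip: exp_add of_real_mult)
  have L: "(\<lambda>z. ?g (fst z) * ?g (snd z)) \<in> L2 (lborel \<Otimes>\<^sub>M lborel)"
    by (rule lborel_pair.L2_mult_pair[OF g g])
  then show "bc_weight \<sigma> \<in> L2 (lborel \<Otimes>\<^sub>M lborel)"
    unfolding w[abs_def] by (auto simp: L2_def norm_mult power_mult_distrib)
  \<comment> \<open>The trivial factor \<open>iexp (x * 0)\<close> makes this an instance of
    \<open>gauss_fourier\<close> at \<open>t = 0\<close>.\<close>
  have "(LINT x|lborel. ?g x * cnj (?g x)) = (LINT x|lborel. of_real (exp (- (sqrt \<sigma> * x)\<^sup>2 / 2)) * iexp (x * 0))"
    unfolding complex_norm_square[symmetric] of_real_power[symmetric] sq by simp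
  also have "\<dots> = of_real (sqrt (2 * pi) / sqrt \<sigma>)"
    using gauss_fourier[of "sqrt \<sigma>" 0] assms by simp
  finally have one: "(LINT x|lborel. ?g x * cnj (?g x)) = of_real (sqrt (2 * pi) / sqrt \<sigma>)" .
  have "(LINT z|(lborel \<Otimes>\<^sub>M lborel). bc_weight \<sigma> z * cnj (bc_weight \<sigma> z)) =
      (LINT z|(lborel \<Otimes>\<^sub>M lborel). (?c * cnj ?c) * (?g (fst z) * ?g (snd z) * cnj (?g (fst z) * ?g (snd z))))"
    unfolding w by (simp add: mult_ac)
  also have "\<dots> = (?c * cnj ?c) * (of_real (sqrt (2 * pi) / sqrt \<sigma>) * of_real (sqrt (2 * pi) / sqrt \<sigma>))"
    by (simp only: integral_mult_right_zero lborel_pair.L2_inner_mult_pair[OF g g g g] one)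
  also have "\<dots> = of_real ((2 * \<sigma> / pi) * ((2 * pi) / \<sigma>))"
    using assms by (simp only: complex_cnj_complex_of_real flip: of_real_mult) (simp flip: real_sqrt_divide)
  also have "\<dots> = 4"
    using assms by simp
  finally show "(LINT z|(lborel \<Otimes>\<^sub>M lborel). bc_weight \<sigma> z * cnj (bc_weight \<sigma> z)) = 4" .
qed

section \<open>Real coordinates and Lebesgue measure on the bicomplex numbers\<close>

abbreviation M2 :: "(real \<times> real) measure" where
  "M2 \<equiv> lborel \<Otimes>\<^sub>M lborel"

lemma sigma_finite_M2: "sigma_finite_measure M2"
  by (simp add: lborel_prod sigma_finite_lborel)

interpretation M4: pair_sigma_finite M2 M2
  by (simp add: pair_sigma_finite_def sigma_finite_M2)

text \<open>The coordinates are grouped by pairs because each component of the transform is a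
  function of one pair times a function of the other.\<close>

definition of_coords :: "(real \<times> real) \<times> (real \<times> real) \<Rightarrow> bicomplex" where
  "of_coords w = Bicomplex (Complex (fst (fst w)) (snd (fst w))) (Complex (fst (snd w)) (snd (snd w)))"

definition coords :: "bicomplex \<Rightarrow> (real \<times> real) \<times> (real \<times> real)" where
  "coords Z = ((Re (bc1 Z), Im (bc1 Z)), (Re (bc2 Z), Im (bc2 Z)))"

lemma of_coords_sel [simp]:
  "bc1 (of_coords w) = Complex (fst (fst w)) (snd (fst w))"
  "bc2 (of_coords w) = Complex (fst (snd w)) (snd (snd w))"
  by (simp_all add: of_coords_def)

lemma coords_of_coords [simp]: "coords (of_coords w) = w"
  by (simp add: coords_def)

lemma measurable_of_coords [measurable]: "of_coords \<in> M2 \<Otimes>\<^sub>M M2 \<rightarrow>\<^sub>M borel"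
  by (rule iffD2[OF borel_measurable_euclidean_space])
    (simp add: Basis_bicomplex_def inner_bicomplex_def inner_complex_def)

lemma measurable_coords [measurable]: "coords \<in> borel \<rightarrow>\<^sub>M M2 \<Otimes>\<^sub>M M2"
proof -
  have "(\<lambda>Z::bicomplex. Z \<bullet> b) \<in> borel_measurable borel" for b by simp
  from this[of "Bicomplex 1 0"] this[of "Bicomplex \<i> 0"] this[of "Bicomplex 0 1"] this[of "Bicomplex 0 \<i>"]
  have [measurable]: "(\<lambda>Z. Re (bc1 Z)) \<in> borel_measurable borel" "(\<lambda>Z. Im (bc1 Z)) \<in> borel_measurable borel"
    "(\<lambda>Z. Re (bc2 Z)) \<in> borel_measurable borel" "(\<lambda>Z. Im (bc2 Z)) \<in> borel_measurable borel"
    by (simp_all add: inner_bicomplex_def inner_complex_def)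
  show ?thesis unfolding coords_def[abs_def] by measurable
qed

text \<open>Lebesgue measure is determined by its values on boxes, and the preimage of a box is a
  product of four intervals.\<close>

lemma lborel_bicomplex: "(lborel :: bicomplex measure) = distr (M2 \<Otimes>\<^sub>M M2) borel of_coords"
proof (rule lborel_eqI)
  fix l u :: bicomplex
  assume le: "\<And>b. b \<in> Basis \<Longrightarrow> l \<bullet> b \<le> u \<bullet> b"
  have le': "Re (bc1 l) \<le> Re (bc1 u)" "Im (bc1 l) \<le> Im (bc1 u)"
    "Re (bc2 l) \<le> Re (bc2 u)" "Im (bc2 l) \<le> Im (bc2 u)"
    using le[of "Bicomplex 1 0"] le[of "Bicomplex \<i> 0"] le[of "Bicomplex 0 1"] le[of "Bicomplex 0 \<i>"]
    by (auto simp: Basis_bicomplex_def inner_bicomplex_def inner_complex_def)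
  have "of_coords -` box l u = ({Re (bc1 l)<..<Re (bc1 u)} \<times> {Im (bc1 l)<..<Im (bc1 u)}) \<times>
      ({Re (bc2 l)<..<Re (bc2 u)} \<times> {Im (bc2 l)<..<Im (bc2 u)})"
    by (auto simp: mem_box Basis_bicomplex_def inner_bicomplex_def inner_complex_def)
  then have "emeasure (distr (M2 \<Otimes>\<^sub>M M2) borel of_coords) (box l u) =
      emeasure (M2 \<Otimes>\<^sub>M M2) (({Re (bc1 l)<..<Re (bc1 u)} \<times> {Im (bc1 l)<..<Im (bc1 u)}) \<times>
        ({Re (bc2 l)<..<Re (bc2 u)} \<times> {Im (bc2 l)<..<Im (bc2 u)}))"
    by (subst emeasure_distr) (simp_all add: space_pair_measure)
  also have "\<dots> = ennreal (Re (bc1 u) - Re (bc1 l)) * ennreal (Im (bc1 u) - Im (bc1 l)) *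
      (ennreal (Re (bc2 u) - Re (bc2 l)) * ennreal (Im (bc2 u) - Im (bc2 l)))"
    using le' by (simp add: sigma_finite_measure.emeasure_pair_measure_Times[OF sigma_finite_M2] lborel.emeasure_pair_measure_Times)
  also have "\<dots> = ennreal (\<Prod>b\<in>Basis. (u - l) \<bullet> b)"
    using le' by (simp add: Basis_bicomplex_def inner_bicomplex_def inner_complex_def mult_ac flip: ennreal_mult)
  finally show "emeasure (distr (M2 \<Otimes>\<^sub>M M2) borel of_coords) (box l u) = ennreal (\<Prod>b\<in>Basis. (u - l) \<bullet> b)" .
qed simp

text \<open>Three reductions: the density contributes \<open>1/4\<close>, Borel measurability of
  \<open>H\<close> removes the completion, and \<open>lborel_bicomplex\<close> moves the integral to
  coordinates.\<close>

lemma
  fixes H :: "bicomplex \<Rightarrow> 'a::{banach, second_countable_topology}"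
  assumes H: "H \<in> borel_measurable borel"
  shows integrable_bc_measure: "integrable bc_measure H \<longleftrightarrow> integrable (M2 \<Otimes>\<^sub>M M2) (\<lambda>w. H (of_coords w))"
    and integral_bc_measure: "(LINT Z|bc_measure. H Z) = (1/4) *\<^sub>R (LINT w|(M2 \<Otimes>\<^sub>M M2). H (of_coords w))"
proof -
  have m: "H \<in> borel_measurable lborel" "H \<in> borel_measurable lebesgue"
    using H by (auto intro: measurable_completion)
  have "integrable bc_measure H \<longleftrightarrow> integrable lebesgue (\<lambda>Z. (1/4) *\<^sub>R H Z)"
    unfolding bc_measure_def by (rule integrable_density[OF m(2)]) auto
  also have "\<dots> \<longleftrightarrow> integrable lebesgue H"
    using integrable_scaleR_right[of 4 lebesgue "\<lambda>Z. (1/4) *\<^sub>R H Z"] by auto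
  also have "\<dots> \<longleftrightarrow> integrable lborel H"
    by (rule integrable_completion[OF m(1)])
  also have "\<dots> \<longleftrightarrow> integrable (M2 \<Otimes>\<^sub>M M2) (\<lambda>w. H (of_coords w))"
    unfolding lborel_bicomplex by (rule integrable_distr_eq[OF measurable_of_coords H])
  finally show "integrable bc_measure H \<longleftrightarrow> integrable (M2 \<Otimes>\<^sub>M M2) (\<lambda>w. H (of_coords w))" .
  have "(LINT Z|bc_measure. H Z) = (LINT Z|lebesgue. (1/4) *\<^sub>R H Z)"
    unfolding bc_measure_def by (rule integral_density[OF m(2)]) auto
  also have "\<dots> = (1/4) *\<^sub>R (LINT Z|lborel. H Z)"
    by (simp add: integral_completion[OF m(1)])
  also have "(LINT Z|lborel. H Z) = (LINT w|(M2 \<Otimes>\<^sub>M M2). H (of_coords w))"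
    unfolding lborel_bicomplex by (rule integral_distr[OF measurable_of_coords H])
  finally show "(LINT Z|bc_measure. H Z) = (1/4) *\<^sub>R (LINT w|(M2 \<Otimes>\<^sub>M M2). H (of_coords w))" .
qed

lemma L2_bc_measure_iff:
  assumes "K \<in> borel_measurable (M2 \<Otimes>\<^sub>M M2)"
  shows "(\<lambda>Z. K (coords Z)) \<in> L2 bc_measure \<longleftrightarrow> K \<in> L2 (M2 \<Otimes>\<^sub>M M2)"
proof -
  note [measurable] = assms
  have b: "(\<lambda>Z. K (coords Z)) \<in> borel_measurable borel" by measurable
  then have "(\<lambda>Z. K (coords Z)) \<in> borel_measurable bc_measure"
    by (simp add: bc_measure_def measurable_completion)
  moreover have "integrable bc_measure (\<lambda>Z. (norm (K (coords Z)))\<^sup>2) \<longleftrightarrow>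
      integrable (M2 \<Otimes>\<^sub>M M2) (\<lambda>w. (norm (K w))\<^sup>2)"
    using b by (subst integrable_bc_measure) simp_all
  ultimately show ?thesis by (simp add: L2_def)
qed

lemma inner_bc_measure:
  assumes [measurable]: "K1 \<in> borel_measurable (M2 \<Otimes>\<^sub>M M2)" "K2 \<in> borel_measurable (M2 \<Otimes>\<^sub>M M2)"
  shows "(LINT Z|bc_measure. K1 (coords Z) * cnj (K2 (coords Z))) =
    (LINT w|(M2 \<Otimes>\<^sub>M M2). K1 w * cnj (K2 w)) / 4"
  by (subst integral_bc_measure) (simp_all add: scaleR_conv_of_real)

section \<open>The transform in components and its Moyal identity\<close>

context
  fixes \<sigma> :: real and \<nu> \<mu> :: bicomplex
  assumes \<sigma>: "\<sigma> > 0" and \<nu>: "\<nu>\<^sup>2 = -1" and \<mu>: "\<mu>\<^sup>2 = -1"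
begin

text \<open>All operations act componentwise. In the \<open>e_plus\<close> component the kernel sees
  only \<open>x1\<close>, \<open>y1\<close> and \<open>\<nu>\<close>, while the swapped coordinates
  put \<open>x2\<close>, \<open>y2\<close> into the Gaussian; in the \<open>e_minus\<close>
  component the roles are exchanged.\<close>

lemma bc_FW_components:
  assumes \<phi>: "\<phi> \<in> L2_bc lebesgue" and \<psi>: "\<psi> \<in> L2_bc lebesgue"
  shows "cplus (bc_FW \<sigma> \<nu> \<mu> \<phi> \<psi> Z) =
      of_real (sqrt (2 * \<sigma> / pi) * exp (- \<sigma> / 4 * (cmod (cminus (z2_unit \<mu> Z)))\<^sup>2)) *
        FW \<sigma> (cplus \<nu>) (\<lambda>t. cplus (\<phi> t)) (\<lambda>t. cplus (\<psi> t)) (cplus (z1_unit \<nu> Z))"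
    and "cminus (bc_FW \<sigma> \<nu> \<mu> \<phi> \<psi> Z) =
      of_real (sqrt (2 * \<sigma> / pi) * exp (- \<sigma> / 4 * (cmod (cplus (z1_unit \<nu> Z)))\<^sup>2)) *
        FW \<sigma> (cminus \<mu>) (\<lambda>t. cminus (\<phi> t)) (\<lambda>t. cminus (\<psi> t)) (cminus (z2_unit \<mu> Z))"
proof -
  let ?x1 = "Re (bc1 Z)" and ?y1 = "Im (bc1 Z)" and ?x2 = "Re (bc2 Z)" and ?y2 = "Im (bc2 Z)"
  let ?X = "?x1 *\<^sub>R e_plus + ?x2 *\<^sub>R e_minus" and ?Y = "?y1 *\<^sub>R e_plus + ?y2 *\<^sub>R e_minus"
  let ?I = "\<lambda>t. \<phi> t *
     bc_exp (\<sigma> *\<^sub>R ((\<nu> * e_plus + \<mu> * e_minus) * (of_real t - (1/2) *\<^sub>R ?X) * ?Y)) *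
     bc_cnj (bc_of_complex (cplus (\<psi> (t - ?x1))) * e_plus + bc_of_complex (cminus (\<psi> (t - ?x2))) * e_minus)"
  let ?p = "\<lambda>t. exp (cplus \<nu> * of_real (\<sigma> * (t - ?x1 / 2) * ?y1)) * cplus (\<phi> t) * cnj (cplus (\<psi> (t - ?x1)))"
  let ?m = "\<lambda>t. exp (cminus \<mu> * of_real (\<sigma> * (t - ?x2 / 2) * ?y2)) * cminus (\<phi> t) * cnj (cminus (\<psi> (t - ?x2)))"
  have p: "cplus (?I t) = ?p t" and m: "cminus (?I t) = ?m t" for t
    by (simp_all add: mult_ac)
  note u = bicomplex_unit_components(1)[OF \<nu>] bicomplex_unit_components(2)[OF \<mu>]
  have "integrable lebesgue ?p" "integrable lebesgue ?m"
    using FW_integrand_integrable[OF L2_bcD(1)[OF \<phi>] L2_bcD(1)[OF \<psi>] u(1)]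
      FW_integrand_integrable[OF L2_bcD(2)[OF \<phi>] L2_bcD(2)[OF \<psi>] u(2)] by simp_all
  then have i: "integrable lebesgue ?I"
    unfolding integrable_bicomplex_iff p m by simp
  have ip: "cplus (LINT t|lebesgue. ?I t) = (LINT t|lebesgue. ?p t)"
    and im: "cminus (LINT t|lebesgue. ?I t) = (LINT t|lebesgue. ?m t)"
    unfolding cplus_integral[OF i] cminus_integral[OF i] p m by simp_all
  \<comment> \<open>The constant \<open>\<sigma> / pi\<close> is shared between the weight and the
    normalization of \<open>FW\<close>.\<close>
  have c: "complex_of_real (sqrt (2 * \<sigma> / pi)) * of_real (sqrt (\<sigma> / (2 * pi))) = of_real (\<sigma> / pi)"
  proof -
    have "sqrt (2 * \<sigma> / pi) * sqrt (\<sigma> / (2 * pi)) = sqrt ((\<sigma> / pi)\<^sup>2)"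
      by (simp only: real_sqrt_mult[symmetric]) (simp add: power2_eq_square)
    also have "\<dots> = \<sigma> / pi" using \<sigma> by simp
    finally show ?thesis by (simp only: flip: of_real_mult)
  qed
  have w: "cplus ((\<sigma> / pi) *\<^sub>R bc_exp ((- \<sigma> / 4) *\<^sub>R
        ((?x2 *\<^sub>R e_plus + ?x1 *\<^sub>R e_minus)\<^sup>2 + (?y2 *\<^sub>R e_plus + ?y1 *\<^sub>R e_minus)\<^sup>2))) =
      of_real (\<sigma> / pi) * of_real (exp (- \<sigma> / 4 * (?x2\<^sup>2 + ?y2\<^sup>2)))"
    "cminus ((\<sigma> / pi) *\<^sub>R bc_exp ((- \<sigma> / 4) *\<^sub>R
        ((?x2 *\<^sub>R e_plus + ?x1 *\<^sub>R e_minus)\<^sup>2 + (?y2 *\<^sub>R e_plus + ?y1 *\<^sub>R e_minus)\<^sup>2))) =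
      of_real (\<sigma> / pi) * of_real (exp (- \<sigma> / 4 * (?x1\<^sup>2 + ?y1\<^sup>2)))"
    by (simp_all flip: exp_of_real)
  have z: "cplus (z1_unit \<nu> Z) = of_real ?x1 + cplus \<nu> * of_real ?y1"
    "cminus (z2_unit \<mu> Z) = of_real ?x2 + cminus \<mu> * of_real ?y2"
    by (simp_all add: z1_unit_def z2_unit_def)
  show "cplus (bc_FW \<sigma> \<nu> \<mu> \<phi> \<psi> Z) =
      of_real (sqrt (2 * \<sigma> / pi) * exp (- \<sigma> / 4 * (cmod (cminus (z2_unit \<mu> Z)))\<^sup>2)) *
        FW \<sigma> (cplus \<nu>) (\<lambda>t. cplus (\<phi> t)) (\<lambda>t. cplus (\<psi> t)) (cplus (z1_unit \<nu> Z))"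
    unfolding cmod_units[OF \<mu>] z(1) FW_eq[OF u(1)]
    unfolding bc_FW_def Let_def cplus_simps(9) ip w c[symmetric]
    by (simp only: of_real_mult mult_ac)
  show "cminus (bc_FW \<sigma> \<nu> \<mu> \<phi> \<psi> Z) =
      of_real (sqrt (2 * \<sigma> / pi) * exp (- \<sigma> / 4 * (cmod (cplus (z1_unit \<nu> Z)))\<^sup>2)) *
        FW \<sigma> (cminus \<mu>) (\<lambda>t. cminus (\<phi> t)) (\<lambda>t. cminus (\<psi> t)) (cminus (z2_unit \<mu> Z))"
    unfolding cmod_units[OF \<nu>] z(2) FW_eq[OF u(2)]
    unfolding bc_FW_def Let_def cminus_simps(9) im w c[symmetric]
    by (simp only: of_real_mult mult_ac)
qed

text \<open>Each component becomes a Borel function of \<open>coords Z\<close> in product form, as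
  the product rules for \<open>L2\<close> require. Equality holds at every \<open>Z\<close>, since
  representatives leave the values of \<open>FW\<close> unchanged.\<close>

lemma bc_FW_coords:
  assumes \<phi>: "\<phi> \<in> L2_bc lebesgue" and \<psi>: "\<psi> \<in> L2_bc lebesgue"
    and fp: "fp \<in> L2 lborel" "AE x in lebesgue. cplus (\<phi> x) = fp x"
    and fm: "fm \<in> L2 lborel" "AE x in lebesgue. cminus (\<phi> x) = fm x"
    and gp: "gp \<in> L2 lborel" "AE x in lebesgue. cplus (\<psi> x) = gp x"
    and gm: "gm \<in> L2 lborel" "AE x in lebesgue. cminus (\<psi> x) = gm x"
  shows "cplus (bc_FW \<sigma> \<nu> \<mu> \<phi> \<psi> Z) =
      (\<lambda>w. FW_real \<sigma> (cplus \<nu>) fp gp (fst w) * bc_weight \<sigma> (snd w)) (coords Z)"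
    and "cminus (bc_FW \<sigma> \<nu> \<mu> \<phi> \<psi> Z) =
      (\<lambda>w. bc_weight \<sigma> (fst w) * FW_real \<sigma> (cminus \<mu>) fm gm (snd w)) (coords Z)"
  unfolding bc_FW_components[OF \<phi> \<psi>] cmod_units[OF \<nu>] cmod_units[OF \<mu>]
    FW_cong_borel[OF L2_bcD(1)[OF \<phi>] fp L2_bcD(1)[OF \<psi>] gp]
    FW_cong_borel[OF L2_bcD(2)[OF \<phi>] fm L2_bcD(2)[OF \<psi>] gm]
  by (simp_all add: FW_real_def bc_weight_def coords_def z1_unit_def z2_unit_def)


text \<open>In each component the integral factorizes into the complex Moyal identity and the
  squared norm of the weight.\<close>

lemma bc_FW_L2_moyal:
  assumes \<phi>: "\<phi>1 \<in> L2_bc lebesgue" "\<phi>2 \<in> L2_bc lebesgue"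
    and \<psi>: "\<psi>1 \<in> L2_bc lebesgue" "\<psi>2 \<in> L2_bc lebesgue"
  shows "bc_FW \<sigma> \<nu> \<mu> \<phi>1 \<psi>1 \<in> L2_bc bc_measure"
    and "bc_inner bc_measure (bc_FW \<sigma> \<nu> \<mu> \<phi>1 \<psi>1) (bc_FW \<sigma> \<nu> \<mu> \<phi>2 \<psi>2) =
      bc_inner lebesgue \<phi>1 \<phi>2 * bc_cnj (bc_inner lebesgue \<psi>1 \<psi>2)"
proof -
  have ex: "\<exists>fp fm. fp \<in> L2 lborel \<and> (AE x in lebesgue. cplus (f x) = fp x) \<and>
      fm \<in> L2 lborel \<and> (AE x in lebesgue. cminus (f x) = fm x)" if "f \<in> L2_bc lebesgue" for f :: "real \<Rightarrow> bicomplex"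
    using L2_lebesgue_borel[OF L2_bcD(1)[OF that]] L2_lebesgue_borel[OF L2_bcD(2)[OF that]] by metis
  obtain f1p f1m where f1: "f1p \<in> L2 lborel" "AE x in lebesgue. cplus (\<phi>1 x) = f1p x"
    "f1m \<in> L2 lborel" "AE x in lebesgue. cminus (\<phi>1 x) = f1m x" using ex[OF \<phi>(1)] by blast
  obtain f2p f2m where f2: "f2p \<in> L2 lborel" "AE x in lebesgue. cplus (\<phi>2 x) = f2p x"
    "f2m \<in> L2 lborel" "AE x in lebesgue. cminus (\<phi>2 x) = f2m x" using ex[OF \<phi>(2)] by blast
  obtain g1p g1m where g1: "g1p \<in> L2 lborel" "AE x in lebesgue. cplus (\<psi>1 x) = g1p x"
    "g1m \<in> L2 lborel" "AE x in lebesgue. cminus (\<psi>1 x) = g1m x" using ex[OF \<psi>(1)] by blast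
  obtain g2p g2m where g2: "g2p \<in> L2 lborel" "AE x in lebesgue. cplus (\<psi>2 x) = g2p x"
    "g2m \<in> L2 lborel" "AE x in lebesgue. cminus (\<psi>2 x) = g2m x" using ex[OF \<psi>(2)] by blast
  let ?Kp = "\<lambda>f g w. FW_real \<sigma> (cplus \<nu>) f g (fst w) * bc_weight \<sigma> (snd w)"
  let ?Km = "\<lambda>f g w. bc_weight \<sigma> (fst w) * FW_real \<sigma> (cminus \<mu>) f g (snd w)"
  note u = bicomplex_unit_components(1)[OF \<nu>] bicomplex_unit_components(2)[OF \<mu>]
  note W = bc_weight_inner[OF \<sigma>]
  have Kp: "?Kp f g \<in> L2 (M2 \<Otimes>\<^sub>M M2)" and Km: "?Km f g \<in> L2 (M2 \<Otimes>\<^sub>M M2)"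
    if "f \<in> L2 lborel" "g \<in> L2 lborel" for f g
    using M4.L2_mult_pair[OF FW_real_L2[OF \<sigma> u(1) that] W(1)]
      M4.L2_mult_pair[OF W(1) FW_real_L2[OF \<sigma> u(2) that]] .
  note V1 = bc_FW_coords[OF \<phi>(1) \<psi>(1) f1 g1]
  note V2 = bc_FW_coords[OF \<phi>(2) \<psi>(2) f2 g2]
  have L2: "(\<lambda>Z. K (coords Z)) \<in> L2 bc_measure" if "K \<in> L2 (M2 \<Otimes>\<^sub>M M2)" for K
    using that L2_bc_measure_iff[OF L2D(1)[OF that]] by simp
  show B1: "bc_FW \<sigma> \<nu> \<mu> \<phi>1 \<psi>1 \<in> L2_bc bc_measure"
    unfolding L2_bc_def mem_Collect_eq V1
    using L2[OF Kp[OF f1(1) g1(1)]] L2[OF Km[OF f1(3) g1(3)]] ..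
  have B2: "bc_FW \<sigma> \<nu> \<mu> \<phi>2 \<psi>2 \<in> L2_bc bc_measure"
    unfolding L2_bc_def mem_Collect_eq V2
    using L2[OF Kp[OF f2(1) g2(1)]] L2[OF Km[OF f2(3) g2(3)]] ..
  have inner: "(LINT x|lebesgue. f x * cnj (g x)) = (LINT x|lborel. f' x * cnj (g' x))"
    if "f \<in> L2 lebesgue" "f' \<in> L2 lborel" "AE x in lebesgue. f x = f' x"
      "g \<in> L2 lebesgue" "g' \<in> L2 lborel" "AE x in lebesgue. g x = g' x" for f f' g g' :: "real \<Rightarrow> complex"
    using integral_lebesgue_cong_borel(1)[of f f' g g' "\<lambda>_. 1" 0] that by (simp add: L2_def)
  show "bc_inner bc_measure (bc_FW \<sigma> \<nu> \<mu> \<phi>1 \<psi>1) (bc_FW \<sigma> \<nu> \<mu> \<phi>2 \<psi>2) =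
      bc_inner lebesgue \<phi>1 \<phi>2 * bc_cnj (bc_inner lebesgue \<psi>1 \<psi>2)"
  proof (rule bicomplex_eqI)
    have "cplus (bc_inner bc_measure (bc_FW \<sigma> \<nu> \<mu> \<phi>1 \<psi>1) (bc_FW \<sigma> \<nu> \<mu> \<phi>2 \<psi>2)) =
        (LINT w|(M2 \<Otimes>\<^sub>M M2). ?Kp f1p g1p w * cnj (?Kp f2p g2p w)) / 4"
      unfolding cplus_bc_inner[OF B1 B2] V1 V2
      by (rule inner_bc_measure[OF L2D(1)[OF Kp[OF f1(1) g1(1)]] L2D(1)[OF Kp[OF f2(1) g2(1)]]])
    \<comment> \<open>The weight contributes \<open>4\<close>, cancelling the quarter from
      \<open>bc_measure\<close>.\<close>
    also have "\<dots> = (LINT x|lborel. f1p x * cnj (f2p x)) * cnj (LINT x|lborel. g1p x * cnj (g2p x))"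
      unfolding M4.L2_inner_mult_pair[OF FW_real_L2[OF \<sigma> u(1) f1(1) g1(1)] W(1) FW_real_L2[OF \<sigma> u(1) f2(1) g2(1)] W(1)]
        W(2) FW_real_moyal[OF \<sigma> u(1) f1(1) g1(1) f2(1) g2(1)] by simp
    also have "\<dots> = cplus (bc_inner lebesgue \<phi>1 \<phi>2 * bc_cnj (bc_inner lebesgue \<psi>1 \<psi>2))"
      unfolding cplus_simps cplus_bc_inner[OF \<phi>] cplus_bc_inner[OF \<psi>]
        inner[OF L2_bcD(1)[OF \<phi>(1)] f1(1,2) L2_bcD(1)[OF \<phi>(2)] f2(1,2)]
        inner[OF L2_bcD(1)[OF \<psi>(1)] g1(1,2) L2_bcD(1)[OF \<psi>(2)] g2(1,2)] ..
    finally show "cplus (bc_inner bc_measure (bc_FW \<sigma> \<nu> \<mu> \<phi>1 \<psi>1) (bc_FW \<sigma> \<nu> \<mu> \<phi>2 \<psi>2)) =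
        cplus (bc_inner lebesgue \<phi>1 \<phi>2 * bc_cnj (bc_inner lebesgue \<psi>1 \<psi>2))" .
    have "cminus (bc_inner bc_measure (bc_FW \<sigma> \<nu> \<mu> \<phi>1 \<psi>1) (bc_FW \<sigma> \<nu> \<mu> \<phi>2 \<psi>2)) =
        (LINT w|(M2 \<Otimes>\<^sub>M M2). ?Km f1m g1m w * cnj (?Km f2m g2m w)) / 4"
      unfolding cminus_bc_inner[OF B1 B2] V1 V2
      by (rule inner_bc_measure[OF L2D(1)[OF Km[OF f1(3) g1(3)]] L2D(1)[OF Km[OF f2(3) g2(3)]]])
    also have "\<dots> = (LINT x|lborel. f1m x * cnj (f2m x)) * cnj (LINT x|lborel. g1m x * cnj (g2m x))"
      unfolding M4.L2_inner_mult_pair[OF W(1) FW_real_L2[OF \<sigma> u(2) f1(3) g1(3)] W(1) FW_real_L2[OF \<sigma> u(2) f2(3) g2(3)]]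
        W(2) FW_real_moyal[OF \<sigma> u(2) f1(3) g1(3) f2(3) g2(3)] by simp
    also have "\<dots> = cminus (bc_inner lebesgue \<phi>1 \<phi>2 * bc_cnj (bc_inner lebesgue \<psi>1 \<psi>2))"
      unfolding cminus_simps cminus_bc_inner[OF \<phi>] cminus_bc_inner[OF \<psi>]
        inner[OF L2_bcD(2)[OF \<phi>(1)] f1(3,4) L2_bcD(2)[OF \<phi>(2)] f2(3,4)]
        inner[OF L2_bcD(2)[OF \<psi>(1)] g1(3,4) L2_bcD(2)[OF \<psi>(2)] g2(3,4)] ..
    finally show "cminus (bc_inner bc_measure (bc_FW \<sigma> \<nu> \<mu> \<phi>1 \<psi>1) (bc_FW \<sigma> \<nu> \<mu> \<phi>2 \<psi>2)) =
        cminus (bc_inner lebesgue \<phi>1 \<phi>2 * bc_cnj (bc_inner lebesgue \<psi>1 \<psi>2))" .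
  qed
qed

end

theorem lemma3p2:
  fixes \<sigma> :: real and \<nu> \<mu> :: bicomplex
  assumes "\<sigma> > 0" and "\<nu>\<^sup>2 = -1" and "\<mu>\<^sup>2 = -1"
  shows "(\<forall>\<phi> \<in> L2_bc lebesgue. \<forall>\<psi> \<in> L2_bc lebesgue.
           (\<forall>Z. bc_FW \<sigma> \<nu> \<mu> \<phi> \<psi> Z =
              bc_of_complex
                (of_real (sqrt (2 * \<sigma> / pi) * exp (- \<sigma> / 4 * (cmod (cminus (z2_unit \<mu> Z)))\<^sup>2)) *
                 FW \<sigma> (cplus \<nu>) (\<lambda>t. cplus (\<phi> t)) (\<lambda>t. cplus (\<psi> t)) (cplus (z1_unit \<nu> Z)))
                * e_plus +
              bc_of_complex
                (of_real (sqrt (2 * \<sigma> / pi) * exp (- \<sigma> / 4 * (cmod (cplus (z1_unit \<nu> Z)))\<^sup>2)) *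
                 FW \<sigma> (cminus \<mu>) (\<lambda>t. cminus (\<phi> t)) (\<lambda>t. cminus (\<psi> t)) (cminus (z2_unit \<mu> Z)))
                * e_minus) \<and>
           bc_FW \<sigma> \<nu> \<mu> \<phi> \<psi> \<in> L2_bc bc_measure) \<and>
         (\<forall>\<phi>1 \<in> L2_bc lebesgue. \<forall>\<phi>2 \<in> L2_bc lebesgue.
         \<forall>\<psi>1 \<in> L2_bc lebesgue. \<forall>\<psi>2 \<in> L2_bc lebesgue.
           bc_inner bc_measure (bc_FW \<sigma> \<nu> \<mu> \<phi>1 \<psi>1) (bc_FW \<sigma> \<nu> \<mu> \<phi>2 \<psi>2) =
           bc_inner lebesgue \<phi>1 \<phi>2 * bc_cnj (bc_inner lebesgue \<psi>1 \<psi>2))"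
proof (intro conjI ballI allI)
  fix \<phi> \<psi> :: "real \<Rightarrow> bicomplex" and Z
  assume "\<phi> \<in> L2_bc lebesgue" "\<psi> \<in> L2_bc lebesgue"
  \<comment> \<open>Uniqueness of the idempotent decomposition reduces the formula to its two
    components.\<close>
  then show "bc_FW \<sigma> \<nu> \<mu> \<phi> \<psi> Z =
      bc_of_complex
        (of_real (sqrt (2 * \<sigma> / pi) * exp (- \<sigma> / 4 * (cmod (cminus (z2_unit \<mu> Z)))\<^sup>2)) *
         FW \<sigma> (cplus \<nu>) (\<lambda>t. cplus (\<phi> t)) (\<lambda>t. cplus (\<psi> t)) (cplus (z1_unit \<nu> Z)))
        * e_plus +
      bc_of_complex
        (of_real (sqrt (2 * \<sigma> / pi) * exp (- \<sigma> / 4 * (cmod (cplus (z1_unit \<nu> Z)))\<^sup>2)) *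
         FW \<sigma> (cminus \<mu>) (\<lambda>t. cminus (\<phi> t)) (\<lambda>t. cminus (\<psi> t)) (cminus (z2_unit \<mu> Z)))
        * e_minus"
    using bc_FW_components[OF assms] by (simp add: idempotent_decomposition)
next
  fix \<phi> \<psi> :: "real \<Rightarrow> bicomplex"
  assume "\<phi> \<in> L2_bc lebesgue" "\<psi> \<in> L2_bc lebesgue"
  then show "bc_FW \<sigma> \<nu> \<mu> \<phi> \<psi> \<in> L2_bc bc_measure"
    using bc_FW_L2_moyal(1)[OF assms] by simp
next
  fix \<phi>1 \<phi>2 \<psi>1 \<psi>2 :: "real \<Rightarrow> bicomplex"
  assume "\<phi>1 \<in> L2_bc lebesgue" "\<phi>2 \<in> L2_bc lebesgue" "\<psi>1 \<in> L2_bc lebesgue" "\<psi>2 \<in> L2_bc lebesgue"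
  then show "bc_inner bc_measure (bc_FW \<sigma> \<nu> \<mu> \<phi>1 \<psi>1) (bc_FW \<sigma> \<nu> \<mu> \<phi>2 \<psi>2) =
      bc_inner lebesgue \<phi>1 \<phi>2 * bc_cnj (bc_inner lebesgue \<psi>1 \<psi>2)"
    by (rule bc_FW_L2_moyal(2)[OF assms])
qed

end
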